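(* Suppose that $M$ is RDDZ, $b,t\ge0$ entrywise, we can sample from $t/\|t\|_1$ in $O(1)$ time, $\|t\|_1$ and $\|D_M^{-1}b\|_\infty$ are known, and $t^{\top}x^{\ast}>0$. Then there exists a randomized algorithm that computes $\hat x$ such that $\Pr\{|\hat x-t^{\top}x^{\ast}|\le\varepsilon\, t^{\top}x^{\ast}\}\ge\frac34$ in expected time $$O\!\left(\frac{f_{\mathrm{row}}(M)\|t\|_1\|D_M^{-1}b\|_\infty L^2}{\varepsilon^2\,t^{\top}x^{\ast}}\right)=\widetilde O\!\left(\frac{f_{\mathrm{row}}(M)\|t\|_1\|D_M^{-1}b\|_\infty}{\gamma^2\varepsilon^2\,t^{\top}x^{\ast}}\right).$$
   Context: Setting: $M\in\mathbb{R}^{n\times n}$, $b\in\operatorname{range}(M)$, $t\in\mathbb{R}^n$, $b,t\ne0$, nonzero entries of absolute value in $[1/\mathrm{poly}(n),\mathrm{poly}(n)]$. RDDZ: positive diagonal, $M(j,j)\ge\sum_{k\ne j}|M(j,k)|$ for all $j$, and nonpositive off-diagonal entries. Write $M=D_M-A_M^{\top}$ ($D_M$ diagonal part, $A_M^{\top}$ zero diagonal); $x^{\ast}:=\frac12\sum_{\ell\ge0}(\frac12(I+D_M^{-1}A_M^{\top}))^{\ell}D_M^{-1}b$. Access: diagonal of $M$ in $O(1)$, nonzero entries of rows/columns of $M$ in time linear in their number, entries of $b,t$ in $O(1)$. The algorithm is given $\varepsilon>0$ and $0<\gamma\le\gamma_{\max}(M)$, where $\gamma_{\max}(M)=\max_{p\in[1,\infty]}\big(1-\|\frac12(I+D_M^{-1/q}A_M^{\top}D_M^{-1/p})|_{\operatorname{range}(I-D_M^{-1/q}A_M^{\top}D_M^{-1/p})}\|_p\big)$,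 $q$ conjugate to $p$. $L=\Theta\big(\frac1\gamma\log(\frac{1}{\gamma E}d_{\max}(M)\|t\|_0\|D_M^{-1}t\|_\infty\|b\|_0\|D_M^{-1}b\|_\infty)\big)$, $E$ the target accuracy, with suitable bounds on the quantities inside the log assumed known. $f_{\mathrm{row}}(M)$: maximum time to simulate one step of the (possibly terminating) random walk with transition matrix $\frac12(I+D_M^{-1}|A_M^{\top}|)$.
   Formalization: For ε ≤ 1 the time bound is as stated; for ε > 1, where the displayed bound can tend to 0 although any algorithm needs one time unit, it is read as O(max(1, ·)) with the argument of the log in L cut off below at 2; a walk step is taken to cost at least one unit. *)

theory Defs
  imports
    "HOL-Probability.Probability_Mass_Function"
    "HOL-Library.Extended_Real"
    "Jordan_Normal_Form.Matrix"
begin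

unbundle no vec_syntax

section \<open>Matrices, norms and the spectral-gap parameter\<close>

definition diag_part :: "real mat \<Rightarrow> real mat" where
  "diag_part M = Matrix.mat (dim_row M) (dim_row M) (\<lambda>(i, j). if i = j then M $$ (i, i) else 0)"

text \<open>The matrix $A_M^\top$ in the decomposition $M = D_M - A_M^\top$.\<close>

definition adj_T :: "real mat \<Rightarrow> real mat" where
  "adj_T M = diag_part M - M"

text \<open>The real power $D_M^r$; it is only used for positive diagonals.\<close>

definition diag_powr :: "real mat \<Rightarrow> real \<Rightarrow> real mat" where
  "diag_powr M r =
     Matrix.mat (dim_row M) (dim_row M) (\<lambda>(i, j). if i = j then (M $$ (i, i)) powr r else 0)"

definition RDDZ :: "nat \<Rightarrow> real mat \<Rightarrow> bool" where
  "RDDZ n M \<longleftrightarrow> M \<in> carrier_mat n n \<and>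
     (\<forall>j<n. 0 < M $$ (j, j)) \<and>
     (\<forall>j<n. (\<Sum>k\<in>{..<n} - {j}. \<bar>M $$ (j, k)\<bar>) \<le> M $$ (j, j)) \<and>
     (\<forall>j<n. \<forall>k<n. j \<noteq> k \<longrightarrow> M $$ (j, k) \<le> 0)"

definition mat_range :: "real mat \<Rightarrow> real Matrix.vec set" where
  "mat_range A = {A *\<^sub>v x | x. x \<in> carrier_vec (dim_col A)}"

definition x_star :: "real mat \<Rightarrow> real Matrix.vec \<Rightarrow> real Matrix.vec" where
  "x_star M b =
     (let n = dim_row M; W = (1/2) \<cdot>\<^sub>m (1\<^sub>m n + diag_powr M (-1) * adj_T M)
      in Matrix.vec n (\<lambda>i. 1/2 * (\<Sum>l. ((W ^\<^sub>m l) *\<^sub>v (diag_powr M (-1) *\<^sub>v b)) $ i)))"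

definition pnorm :: "ereal \<Rightarrow> real Matrix.vec \<Rightarrow> real" where
  "pnorm p v =
     (if p = \<infinity> then Max ((\<lambda>i. \<bar>v $ i\<bar>) ` {..<dim_vec v})
      else (\<Sum>i<dim_vec v. \<bar>v $ i\<bar> powr real_of_ereal p) powr (1 / real_of_ereal p))"

definition norm0 :: "real Matrix.vec \<Rightarrow> nat" where
  "norm0 v = card {i. i < dim_vec v \<and> v $ i \<noteq> 0}"

text \<open>
  In type \<open>ereal\<close>, \<open>inverse \<infinity> = 0\<close> and \<open>inverse 0 = \<infinity>\<close>, so the endpoints
  \<open>1\<close> and \<open>\<infinity>\<close> are conjugate to each other.
\<close>

definition conj_exponent :: "ereal \<Rightarrow> ereal" where
  "conj_exponent p = inverse (1 - inverse p)"

text \<open>The matrix $D_M^{-1/q} A_M^\top D_M^{-1/p}$.\<close>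

definition scaled_adj_T :: "real mat \<Rightarrow> ereal \<Rightarrow> real mat" where
  "scaled_adj_T M p =
     diag_powr M (- real_of_ereal (inverse (conj_exponent p))) * adj_T M *
     diag_powr M (- real_of_ereal (inverse p))"

text \<open>As for \<open>onorm\<close>, the zero vector contributes the value \<open>0 / 0 = 0\<close>.\<close>

definition restricted_opnorm :: "ereal \<Rightarrow> real mat \<Rightarrow> real Matrix.vec set \<Rightarrow> real" where
  "restricted_opnorm p A U = (SUP x\<in>U. pnorm p (A *\<^sub>v x) / pnorm p x)"

text \<open>
  The maximum over $p \in [1, \infty]$, taken as a supremum; the family is bounded above by 1.
\<close>

definition gamma_max :: "real mat \<Rightarrow> real" where
  "gamma_max M =
     (SUP p\<in>{1..\<infinity>}.
        1 - restricted_opnorm p ((1/2) \<cdot>\<^sub>m (1\<^sub>m (dim_row M) + scaled_adj_T M p))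
              (mat_range (1\<^sub>m (dim_row M) - scaled_adj_T M p)))"

definition d_max :: "real mat \<Rightarrow> real" where
  "d_max M = Max ((\<lambda>i. M $$ (i, i)) ` {..<dim_row M})"

text \<open>
  Nonzero entries of absolute value in $[1/\mathrm{poly}(n), \mathrm{poly}(n)]$.  As \<open>n \<ge> 1\<close>, a
  function of \<open>n\<close> is polynomially bounded iff it is at most \<open>(n + 1) ^ a\<close> for some constant \<open>a\<close>
  (base \<open>n + 1\<close> rather than \<open>n\<close>, so that \<open>n = 1\<close> is not forced to entries of modulus 1).
\<close>

definition poly_range :: "nat \<Rightarrow> nat \<Rightarrow> real \<Rightarrow> bool" where
  "poly_range a n x \<longleftrightarrow> x = 0 \<or> 1 / (real n + 1) ^ a \<le> \<bar>x\<bar> \<and> \<bar>x\<bar> \<le> (real n + 1) ^ a"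

definition admissible ::
  "nat \<Rightarrow> nat \<Rightarrow> real mat \<Rightarrow> real Matrix.vec \<Rightarrow> real Matrix.vec \<Rightarrow> bool" where
  "admissible a n M b t \<longleftrightarrow>
     M \<in> carrier_mat n n \<and> b \<in> carrier_vec n \<and> t \<in> carrier_vec n \<and>
     b \<in> mat_range M \<and> b \<noteq> 0\<^sub>v n \<and> t \<noteq> 0\<^sub>v n \<and>
     (\<forall>i<n. \<forall>j<n. poly_range a n (M $$ (i, j))) \<and>
     (\<forall>i<n. poly_range a n (b $ i)) \<and> (\<forall>i<n. poly_range a n (t $ i))"

definition log_arg ::
  "real mat \<Rightarrow> real Matrix.vec \<Rightarrow> real Matrix.vec \<Rightarrow> real \<Rightarrow> real \<Rightarrow> real" where
  "log_arg M b t \<gamma> E =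
     1 / (\<gamma> * E) * d_max M * real (norm0 t) * pnorm \<infinity> (diag_powr M (-1) *\<^sub>v t)
       * real (norm0 b) * pnorm \<infinity> (diag_powr M (-1) *\<^sub>v b)"

text \<open>
  The quantity $L$ up to constant factors.  For accuracy \<open>E = \<epsilon> * (t \<bullet> x_star M b)\<close> and
  \<open>0 < \<gamma> \<le> gamma_max M\<close> Hoelder's inequality gives \<open>log_arg M b t \<gamma> E \<ge> 2 / \<epsilon>\<close>, so the cut-off
  at 2 only matters for \<open>\<epsilon> > 1\<close>, where the logarithm could otherwise be negative.
\<close>

definition L_param ::
  "real mat \<Rightarrow> real Matrix.vec \<Rightarrow> real Matrix.vec \<Rightarrow> real \<Rightarrow> real \<Rightarrow> real" where
  "L_param M b t \<gamma> E = 1 / \<gamma> * ln (max 2 (log_arg M b t \<gamma> E))"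

section \<open>Sampling primitives\<close>

definition t_distr :: "real Matrix.vec \<Rightarrow> nat pmf" where
  "t_distr t = embed_pmf (\<lambda>i. if i < dim_vec t then t $ i / pnorm 1 t else 0)"

definition walk_mat :: "real mat \<Rightarrow> real mat" where
  "walk_mat M = (1/2) \<cdot>\<^sub>m (1\<^sub>m (dim_row M) + diag_powr M (-1) * map_mat abs (adj_T M))"

text \<open>
  One step of the terminating walk on \<open>{..<n}\<close>; the missing mass of a row is the probability of
  termination, which is encoded by the absorbing value \<open>n\<close>.
\<close>

definition walk_step :: "real mat \<Rightarrow> nat \<Rightarrow> nat pmf" where
  "walk_step M v =
     (let n = dim_row M in
      if v < n then
        embed_pmf (\<lambda>w. if w < n then walk_mat M $$ (v, w)
                       else if w = n then 1 - (\<Sum>k<n. walk_mat M $$ (v, k)) else 0)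
      else return_pmf n)"

text \<open>
  \<open>\<tau> v\<close> is the time that the simulator takes for one step of the walk from \<open>v\<close>.
\<close>

definition f_row :: "nat \<Rightarrow> (nat \<Rightarrow> real) \<Rightarrow> real" where
  "f_row n \<tau> = Max (\<tau> ` {..<n})"

section \<open>A randomized real RAM with access to $M$, $b$ and $t$\<close>

text \<open>
  A configuration consists of the program counter, a memory of natural numbers and a memory of
  reals, both with direct and indirect addressing.  There is no rounding of reals, and program
  constants are integers, so that no uncomputable real can be hard-wired into a program.
  The first operand of an instruction is the destination, except for jumps, which go to the third
  operand if the first one is smaller than the second one.
\<close>

datatype instr =
    IConst nat nat | IAdd nat nat nat | ISub nat nat nat
  | ILoad nat nat | IStore nat nat
  | RConst nat int | RAdd nat nat nat | RSub nat nat nat | RMul nat nat nat | RDiv nat nat nat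
  | RLoad nat nat | RStore nat nat
  | ROfI nat nat
  | JumpILess nat nat nat | JumpRLess nat nat nat
  | GetDiag nat nat | GetB nat nat | GetT nat nat
  | GetRow nat nat | GetCol nat nat
  | Flip nat
  | SampleT nat
  | WalkStep nat nat

type_synonym config = "nat \<times> (nat \<Rightarrow> nat) \<times> (nat \<Rightarrow> real)"

definition row_entries :: "real mat \<Rightarrow> nat \<Rightarrow> (nat \<times> real) list" where
  "row_entries M i =
     (if i < dim_row M
      then map (\<lambda>k. (k, M $$ (i, k))) (filter (\<lambda>k. M $$ (i, k) \<noteq> 0) [0..<dim_col M]) else [])"

definition col_entries :: "real mat \<Rightarrow> nat \<Rightarrow> (nat \<times> real) list" where
  "col_entries M j =
     (if j < dim_col M
      then map (\<lambda>k. (k, M $$ (k, j))) (filter (\<lambda>k. M $$ (k, j) \<noteq> 0) [0..<dim_row M]) else [])"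

text \<open>
  Write the length of a list at address \<open>a\<close> of the first memory, and its entries at the addresses
  \<open>a + 1, a + 2, \<dots>\<close> of the two memories.
\<close>

definition store_I :: "nat \<Rightarrow> (nat \<times> real) list \<Rightarrow> (nat \<Rightarrow> nat) \<Rightarrow> nat \<Rightarrow> nat" where
  "store_I a es I x =
     (if x = a then length es
      else if a < x \<and> x \<le> a + length es then fst (es ! (x - a - 1)) else I x)"

definition store_R :: "nat \<Rightarrow> (nat \<times> real) list \<Rightarrow> (nat \<Rightarrow> real) \<Rightarrow> nat \<Rightarrow> real" where
  "store_R a es R x =
     (if a < x \<and> x \<le> a + length es then snd (es ! (x - a - 1)) else R x)"

context
  fixes M :: "real mat" and b t :: "real Matrix.vec" and \<tau> :: "nat \<Rightarrow> real"
begin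

fun exec :: "instr \<Rightarrow> config \<Rightarrow> config pmf" where
  "exec (IConst d c) (pc, I, R) = return_pmf (Suc pc, I(d := c), R)"
| "exec (IAdd d i j) (pc, I, R) = return_pmf (Suc pc, I(d := I i + I j), R)"
| "exec (ISub d i j) (pc, I, R) = return_pmf (Suc pc, I(d := I i - I j), R)"
| "exec (ILoad d i) (pc, I, R) = return_pmf (Suc pc, I(d := I (I i)), R)"
| "exec (IStore d i) (pc, I, R) = return_pmf (Suc pc, I(I d := I i), R)"
| "exec (RConst d c) (pc, I, R) = return_pmf (Suc pc, I, R(d := of_int c))"
| "exec (RAdd d i j) (pc, I, R) = return_pmf (Suc pc, I, R(d := R i + R j))"
| "exec (RSub d i j) (pc, I, R) = return_pmf (Suc pc, I, R(d := R i - R j))"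
| "exec (RMul d i j) (pc, I, R) = return_pmf (Suc pc, I, R(d := R i * R j))"
| "exec (RDiv d i j) (pc, I, R) = return_pmf (Suc pc, I, R(d := R i / R j))"
| "exec (RLoad d i) (pc, I, R) = return_pmf (Suc pc, I, R(d := R (I i)))"
| "exec (RStore d i) (pc, I, R) = return_pmf (Suc pc, I, R(I d := R i))"
| "exec (ROfI d i) (pc, I, R) = return_pmf (Suc pc, I, R(d := real (I i)))"
| "exec (JumpILess i j l) (pc, I, R) = return_pmf (if I i < I j then l else Suc pc, I, R)"
| "exec (JumpRLess i j l) (pc, I, R) = return_pmf (if R i < R j then l else Suc pc, I, R)"
| "exec (GetDiag d i) (pc, I, R) =
     return_pmf (Suc pc, I, R(d := if I i < dim_row M then M $$ (I i, I i) else 0))"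
| "exec (GetB d i) (pc, I, R) =
     return_pmf (Suc pc, I, R(d := if I i < dim_vec b then b $ I i else 0))"
| "exec (GetT d i) (pc, I, R) =
     return_pmf (Suc pc, I, R(d := if I i < dim_vec t then t $ I i else 0))"
| "exec (GetRow d i) (pc, I, R) =
     (let es = row_entries M (I i) in return_pmf (Suc pc, store_I (I d) es I, store_R (I d) es R))"
| "exec (GetCol d i) (pc, I, R) =
     (let es = col_entries M (I i) in return_pmf (Suc pc, store_I (I d) es I, store_R (I d) es R))"
| "exec (Flip d) (pc, I, R) =
     map_pmf (\<lambda>h. (Suc pc, I(d := if h then 1 else 0), R)) (bernoulli_pmf (1/2))"
| "exec (SampleT d) (pc, I, R) = map_pmf (\<lambda>v. (Suc pc, I(d := v), R)) (t_distr t)"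
| "exec (WalkStep d i) (pc, I, R) = map_pmf (\<lambda>v. (Suc pc, I(d := v), R)) (walk_step M (I i))"

fun instr_time :: "instr \<Rightarrow> config \<Rightarrow> real" where
  "instr_time (GetRow d i) (pc, I, R) = 1 + real (length (row_entries M (I i)))"
| "instr_time (GetCol d i) (pc, I, R) = 1 + real (length (col_entries M (I i)))"
| "instr_time (WalkStep d i) (pc, I, R) = (if I i < dim_row M then \<tau> (I i) else 1)"
| "instr_time _ _ = 1"

definition halted :: "instr list \<Rightarrow> config \<Rightarrow> bool" where
  "halted P c \<longleftrightarrow> length P \<le> fst c"

definition step :: "instr list \<Rightarrow> config \<Rightarrow> config pmf" where
  "step P c = (if halted P c then return_pmf c else exec (P ! fst c) c)"

definition step_time :: "instr list \<Rightarrow> config \<Rightarrow> real" where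
  "step_time P c = (if halted P c then 0 else instr_time (P ! fst c) c)"

primrec run :: "instr list \<Rightarrow> config \<Rightarrow> nat \<Rightarrow> config pmf" where
  "run P c 0 = return_pmf c"
| "run P c (Suc k) = bind_pmf (run P c k) (step P)"

definition expected_time :: "instr list \<Rightarrow> config \<Rightarrow> ennreal" where
  "expected_time P c = (\<Sum>k. \<integral>\<^sup>+ c'. ennreal (step_time P c') \<partial>measure_pmf (run P c k))"

text \<open>
  The probability that the program halts with an output (the real register 0) in \<open>S\<close>; the
  probabilities under the supremum increase with \<open>k\<close>.
\<close>

definition output_prob :: "instr list \<Rightarrow> config \<Rightarrow> real set \<Rightarrow> real" where
  "output_prob P c S =
     (SUP k. measure_pmf.prob (run P c k) {c'. halted P c' \<and> snd (snd c') 0 \<in> S})"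

text \<open>
  The quantities known to the algorithm: \<open>n\<close>, \<open>\<epsilon>\<close>, \<open>\<gamma>\<close>, the two norms, and a bound \<open>B\<close> on the
  argument of the logarithm in $L$.
\<close>

definition init_config :: "real \<Rightarrow> real \<Rightarrow> real \<Rightarrow> config" where
  "init_config \<epsilon> \<gamma> B =
     (0, (\<lambda>_. 0)(0 := dim_row M),
      (\<lambda>_. 0)(1 := \<epsilon>, 2 := \<gamma>, 3 := pnorm 1 t, 4 := pnorm \<infinity> (diag_powr M (-1) *\<^sub>v b), 5 := B))"

end

end

theory Submission
  imports Defs
begin

text \<open>
  Write $W = \frac12 (I + D_M^{-1} A_M^\top)$. As $M$ is RDDZ, $W$ is nonnegative with row sums at
  most 1, so $t^\top x^* = \frac12 \|t\|_1 \sum_l \mathbb{E} (D_M^{-1} b)(X_l)$ for the terminating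
  walk with $X_0 \sim t / \|t\|_1$. Conjugation by $D_M^{1/p}$ turns $W$ into the matrix in the
  definition of $\gamma_{\max}$, and $b \in \mathrm{range}(M)$ puts all iterates into the range on
  which that matrix contracts; hence the terms decay like $(1 - \gamma/2)^l$ and truncating the sum
  after $N = O(L)$ terms costs a relative error of at most $\varepsilon / 4$.

  The truncated sum along one walk is a sample $Z \in [0, K]$ with $K = N \|D_M^{-1} b\|_\infty$.
  Its mean $\mu$ is unknown, so samples are drawn until their sum exceeds
  $\theta = 100 K / \varepsilon^2$, and $\theta / J$ estimates $\mu$, where $J$ is the number of
  samples. As $Z \ge 0$, stopping too early or too late are events about sums of a fixed number of
  samples, and Chebyshev's inequality with $\mathrm{Var}(Z) \le K \mu$ bounds them. The expected
  number of samples is at most $(\theta + K) / \mu$. For $\varepsilon \ge 1$ the output 0 is good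
  enough.
\<close>

section \<open>Norms and the decay of the walk\<close>

text \<open>The exponent \<open>p\<close> behind \<open>gamma_max\<close> depends on
  \<open>M\<close> and is invisible to the program, so every estimate must become free of
  \<open>p\<close>: the weights \<open>D^(1/p)\<close> and \<open>D^(1/q)\<close>, paid on the sides
  of \<open>b\<close> and \<open>t\<close>, multiply to one factor \<open>d_max\<close>, and
  \<open>p\<close>-norms are traded for \<open>norm0\<close> times a maximum. This is how
  \<open>log_arg\<close> arises. The rate is \<open>1 - \<gamma> / 2\<close> instead of
  \<open>1 - \<gamma>\<close> because \<open>gamma_max\<close> is a supremum.

  The machine has no logarithm, so it finds \<open>N\<close> by multiplying \<open>4 * B\<close> by
  \<open>1 - \<gamma> / 2\<close> until the product is at most 1; the factor 4 buys the truncation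
  error \<open>\<epsilon> / 4\<close>, and sampling adds at most \<open>\<epsilon> / 2\<close>.

  No probability space of infinite sample sequences is built. Running time and failure probability
  both obey a one-step inequality along the program, and their bounds are checked by induction
  against functions of the running sum. A run that has not halted counts as a failure, so almost
  sure termination needs no proof of its own.\<close>

lemma pnorm_nonneg: "0 < dim_vec v \<Longrightarrow> 0 \<le> pnorm p v"
  by (auto simp: pnorm_def intro!: order_trans[OF abs_ge_zero Max_ge])

lemma abs_le_pnorm:
  assumes "1 \<le> p" "i < dim_vec v"
  shows "\<bar>v $ i\<bar> \<le> pnorm p v"
proof (cases "p = \<infinity>")
  case True
  then show ?thesis using assms by (auto simp: pnorm_def intro: Max_ge)
next
  case False
  then obtain r where r: "p = ereal r" "1 \<le> r" using assms by (cases p) auto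
  have "\<bar>v $ i\<bar> = (\<bar>v $ i\<bar> powr r) powr (1 / r)"
    using r by (simp add: powr_powr)
  also have "\<dots> \<le> (\<Sum>i<dim_vec v. \<bar>v $ i\<bar> powr r) powr (1 / r)"
    using assms r by (intro powr_mono2 member_le_sum) auto
  finally show ?thesis using r by (simp add: pnorm_def)
qed

text \<open>Only the support contributes, and \<open>k powr (1 / p) \<le> k\<close> for an integer
  \<open>k \<ge> 1\<close>, which makes the bound uniform in \<open>p\<close>. An empty support is
  treated apart, since this inequality and the case of the maximum need
  \<open>k \<ge> 1\<close>.\<close>

lemma pnorm_le_norm0:
  assumes "1 \<le> p" "0 < dim_vec v" "\<And>i. i < dim_vec v \<Longrightarrow> \<bar>v $ i\<bar> \<le> c"
  shows "pnorm p v \<le> real (norm0 v) * c"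
proof -
  let ?A = "{i. i < dim_vec v \<and> v $ i \<noteq> 0}"
  have c: "0 \<le> c" using assms(2) assms(3)[of 0] by simp
  show ?thesis
  proof (cases "?A = {}")
    case True
    then have "(\<lambda>i. \<bar>v $ i\<bar>) ` {..<dim_vec v} = {0}"
      using assms(2) by force
    moreover have "(\<Sum>i<dim_vec v. \<bar>v $ i\<bar> powr r) = 0" for r
      using True by (intro sum.neutral) auto
    ultimately show ?thesis
      using c by (simp add: pnorm_def)
  next
    case False
    then have n1: "1 \<le> real (norm0 v)"
      by (simp add: norm0_def card_gt_0_iff Suc_le_eq del: Collect_empty_eq)
    then have cn: "c \<le> real (norm0 v) * c" using c by (simp add: mult_le_cancel_right1)
    show ?thesis
    proof (cases "p = \<infinity>")
      case True
      have "Max ((\<lambda>i. \<bar>v $ i\<bar>) ` {..<dim_vec v}) \<le> c"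
        using assms by (subst Max_le_iff) auto
      with True cn show ?thesis by (simp add: pnorm_def)
    next
      case False
      then obtain r where r: "p = ereal r" "1 \<le> r" using assms by (cases p) auto
      have "(\<Sum>i<dim_vec v. \<bar>v $ i\<bar> powr r) = (\<Sum>i\<in>?A. \<bar>v $ i\<bar> powr r)"
        by (rule sum.mono_neutral_right) auto
      also have "\<dots> \<le> (\<Sum>i\<in>?A. c powr r)"
        using assms r by (intro sum_mono powr_mono2) auto
      also have "\<dots> = real (norm0 v) * c powr r" by (simp add: norm0_def)
      finally have "(\<Sum>i<dim_vec v. \<bar>v $ i\<bar> powr r) powr (1 / r) \<le>
          (real (norm0 v) * c powr r) powr (1 / r)"
        using r by (intro powr_mono2 sum_nonneg) auto
      also have "\<dots> = real (norm0 v) powr (1 / r) * c"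
        using r c by (simp add: powr_mult powr_powr)
      also have "\<dots> \<le> real (norm0 v) * c"
        using powr_mono[of "1 / r" 1 "real (norm0 v)"] n1 r c by (intro mult_right_mono) auto
      finally show ?thesis using r by (simp add: pnorm_def)
    qed
  qed
qed

lemma norm0_le_dim: "norm0 v \<le> dim_vec v"
  unfolding norm0_def using card_mono[of "{..<dim_vec v}" "{i. i < dim_vec v \<and> v $ i \<noteq> 0}"] by auto

text \<open>A crude bound whose size is irrelevant: it only shows that the supremum defining
  \<open>restricted_opnorm\<close> ranges over a bounded set.\<close>

lemma pnorm_mult_mat_vec_le:
  assumes "1 \<le> p" "0 < dim_row A" "dim_vec v = dim_col A" "0 < dim_vec v"
  shows "pnorm p (A *\<^sub>v v) \<le>
    real (dim_row A) * (\<Sum>i<dim_row A. \<Sum>j<dim_col A. \<bar>A $$ (i, j)\<bar>) * pnorm p v"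
proof -
  let ?S = "\<Sum>i<dim_row A. \<Sum>j<dim_col A. \<bar>A $$ (i, j)\<bar>"
  have nn: "0 \<le> pnorm p v" using assms pnorm_nonneg by simp
  have "\<bar>(A *\<^sub>v v) $ i\<bar> \<le> ?S * pnorm p v" if i: "i < dim_vec (A *\<^sub>v v)" for i
  proof -
    have "\<bar>(A *\<^sub>v v) $ i\<bar> = \<bar>\<Sum>j<dim_col A. A $$ (i, j) * v $ j\<bar>"
      using i assms(3) by (simp add: scalar_prod_def atLeast0LessThan)
    also have "\<dots> \<le> (\<Sum>j<dim_col A. \<bar>A $$ (i, j) * v $ j\<bar>)"
      by (rule sum_abs)
    also have "\<dots> \<le> (\<Sum>j<dim_col A. \<bar>A $$ (i, j)\<bar> * pnorm p v)"
      using assms abs_le_pnorm[of p _ v] by (intro sum_mono) (auto simp: abs_mult intro: mult_left_mono)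
    also have "\<dots> = (\<Sum>j<dim_col A. \<bar>A $$ (i, j)\<bar>) * pnorm p v" by (simp add: sum_distrib_right)
    also have "\<dots> \<le> ?S * pnorm p v"
      using i nn by (intro mult_right_mono member_le_sum[where f = "\<lambda>i. \<Sum>j<dim_col A. \<bar>A $$ (i, j)\<bar>"])
        (auto intro: sum_nonneg)
    finally show ?thesis .
  qed
  then have "pnorm p (A *\<^sub>v v) \<le> real (norm0 (A *\<^sub>v v)) * (?S * pnorm p v)"
    using assms by (intro pnorm_le_norm0) auto
  also have "\<dots> \<le> real (dim_row A) * (?S * pnorm p v)"
    using norm0_le_dim[of "A *\<^sub>v v"] nn by (intro mult_right_mono mult_nonneg_nonneg sum_nonneg) auto
  finally show ?thesis by (simp add: mult.assoc)
qed

text \<open>A real \<open>SUP\<close> dominates its family only if the family is bounded, which the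
  crude constant \<open>C\<close> provides. \<open>C\<close> also settles vectors of norm 0, whose
  quotient \<open>0 / 0 = 0\<close> carries no information.\<close>

lemma restricted_opnorm_bound:
  assumes "1 \<le> p" "A \<in> carrier_mat n n" "0 < n" "U \<subseteq> carrier_vec n" "x \<in> U"
  shows "pnorm p (A *\<^sub>v x) \<le> restricted_opnorm p A U * pnorm p x"
    and "0 \<le> restricted_opnorm p A U"
proof -
  define C where "C = real n * (\<Sum>i<n. \<Sum>j<n. \<bar>A $$ (i, j)\<bar>)"
  have C0: "0 \<le> C" unfolding C_def by (intro mult_nonneg_nonneg sum_nonneg) auto
  have C: "pnorm p (A *\<^sub>v x) \<le> C * pnorm p x" if "x \<in> U" for x
    using pnorm_mult_mat_vec_le[of p A x] assms that unfolding C_def by auto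
  have nn: "0 \<le> pnorm p x" if "x \<in> U" for x
    using assms that by (intro pnorm_nonneg) auto
  have "pnorm p (A *\<^sub>v x) / pnorm p x \<le> C" if "x \<in> U" for x
    using C[OF that] nn[OF that] C0
    by (cases "pnorm p x = 0") (simp_all add: divide_le_eq)
  then have bdd: "bdd_above ((\<lambda>x. pnorm p (A *\<^sub>v x) / pnorm p x) ` U)"
    by (intro bdd_aboveI2[of _ _ C]) auto
  have le: "pnorm p (A *\<^sub>v x) / pnorm p x \<le> restricted_opnorm p A U"
    unfolding restricted_opnorm_def by (rule cSUP_upper[OF assms(5) bdd])
  show "pnorm p (A *\<^sub>v x) \<le> restricted_opnorm p A U * pnorm p x"
  proof (cases "pnorm p x = 0")
    case True
    then show ?thesis using C[OF assms(5)] by simp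
  next
    case False
    then have "0 < pnorm p x" using nn[OF assms(5)] by simp
    with le show ?thesis by (simp add: pos_divide_le_eq)
  qed
  have "0 \<le> pnorm p (A *\<^sub>v x) / pnorm p x"
    using assms nn by (intro divide_nonneg_nonneg pnorm_nonneg) auto
  with le show "0 \<le> restricted_opnorm p A U" by simp
qed

section \<open>Entrywise action of diagonal scalings\<close>

lemma diag_powr_mult_vec:
  assumes "M \<in> carrier_mat n n" "v \<in> carrier_vec n" "i < n"
  shows "(diag_powr M r *\<^sub>v v) $ i = M $$ (i, i) powr r * v $ i"
proof -
  have "(diag_powr M r *\<^sub>v v) $ i = (\<Sum>j<n. (if i = j then M $$ (i, i) powr r else 0) * v $ j)"
    using assms by (simp add: diag_powr_def scalar_prod_def atLeast0LessThan)
  also have "\<dots> = (\<Sum>j<n. if i = j then M $$ (i, i) powr r * v $ j else 0)"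
    by (rule sum.cong) auto
  finally show ?thesis using assms by simp
qed

lemma diag_powr_mult_mat:
  assumes "M \<in> carrier_mat n n" "A \<in> carrier_mat n n" "i < n" "j < n"
  shows "(diag_powr M r * A) $$ (i, j) = M $$ (i, i) powr r * A $$ (i, j)"
proof -
  have "(diag_powr M r * A) $$ (i, j) = (\<Sum>k<n. (if i = k then M $$ (i, i) powr r else 0) * A $$ (k, j))"
    using assms by (simp add: diag_powr_def scalar_prod_def atLeast0LessThan)
  also have "\<dots> = (\<Sum>k<n. if i = k then M $$ (i, i) powr r * A $$ (k, j) else 0)"
    by (rule sum.cong) auto
  finally show ?thesis using assms by simp
qed

lemma mat_mult_diag_powr:
  assumes "M \<in> carrier_mat n n" "A \<in> carrier_mat n n" "i < n" "j < n"
  shows "(A * diag_powr M r) $$ (i, j) = A $$ (i, j) * M $$ (j, j) powr r"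
proof -
  have "(A * diag_powr M r) $$ (i, j) = (\<Sum>k<n. A $$ (i, k) * (if k = j then M $$ (k, k) powr r else 0))"
    using assms by (simp add: diag_powr_def scalar_prod_def atLeast0LessThan)
  also have "\<dots> = (\<Sum>k<n. if k = j then A $$ (i, k) * M $$ (j, j) powr r else 0)"
    by (rule sum.cong) auto
  finally show ?thesis using assms by simp
qed
lemma half_add_mult_vec:
  fixes S :: "real mat"
  assumes "S \<in> carrier_mat n n" "u \<in> carrier_vec n" "i < n"
  shows "(((1/2) \<cdot>\<^sub>m (1\<^sub>m n + S)) *\<^sub>v u) $ i = 1/2 * (u $ i + (\<Sum>j<n. S $$ (i, j) * u $ j))"
proof -
  have "(((1/2) \<cdot>\<^sub>m (1\<^sub>m n + S)) *\<^sub>v u) $ i =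
      (\<Sum>j<n. 1/2 * (((if i = j then 1 else 0) + S $$ (i, j)) * u $ j))"
    using assms by (simp add: scalar_prod_def atLeast0LessThan eq_commute[of i])
  also have "\<dots> = (\<Sum>j<n. 1/2 * ((if i = j then u $ j else 0) + S $$ (i, j) * u $ j))"
    by (rule sum.cong) (auto simp: algebra_simps)
  also have "\<dots> = 1/2 * (u $ i + (\<Sum>j<n. S $$ (i, j) * u $ j))"
    unfolding sum_distrib_left[symmetric] sum.distrib using assms by simp
  finally show ?thesis .
qed

lemma one_minus_mult_vec:
  fixes S :: "real mat"
  assumes "S \<in> carrier_mat n n" "u \<in> carrier_vec n" "i < n"
  shows "((1\<^sub>m n - S) *\<^sub>v u) $ i = u $ i - (\<Sum>j<n. S $$ (i, j) * u $ j)"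
proof -
  have "((1\<^sub>m n - S) *\<^sub>v u) $ i = (\<Sum>j<n. ((if i = j then 1 else 0) - S $$ (i, j)) * u $ j)"
    using assms by (simp add: scalar_prod_def atLeast0LessThan eq_commute[of i])
  also have "\<dots> = (\<Sum>j<n. (if i = j then u $ j else 0) - S $$ (i, j) * u $ j)"
    by (rule sum.cong) (auto simp: algebra_simps)
  also have "\<dots> = u $ i - (\<Sum>j<n. S $$ (i, j) * u $ j)"
    unfolding sum_subtractf using assms by simp
  finally show ?thesis .
qed

text \<open>Only the reciprocals of \<open>p\<close> and \<open>q\<close> enter
  \<open>scaled_adj_T\<close>. They are real numbers adding up to 1 even at the endpoints, so the
  conjugation argument can work with \<open>\<alpha> = 1/p\<close> in \<open>[0, 1]\<close> without
  a case distinction.\<close>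

lemma conj_exponent_inverse:
  assumes "1 \<le> p"
  shows "real_of_ereal (inverse (conj_exponent p)) = 1 - real_of_ereal (inverse p)"
    and "0 \<le> real_of_ereal (inverse p)" "real_of_ereal (inverse p) \<le> 1"
proof -
  consider "p = \<infinity>" | r where "p = ereal r" "1 \<le> r"
    using assms by (cases p) auto
  then have "real_of_ereal (inverse (conj_exponent p)) = 1 - real_of_ereal (inverse p) \<and>
      0 \<le> real_of_ereal (inverse p) \<and> real_of_ereal (inverse p) \<le> 1"
  proof cases
    case 1
    then show ?thesis by (simp add: conj_exponent_def one_ereal_def)
  next
    case (2 r)
    then show ?thesis
      by (cases "r = 1") (simp_all add: conj_exponent_def one_ereal_def divide_simps)
  qed
  then show "real_of_ereal (inverse (conj_exponent p)) = 1 - real_of_ereal (inverse p)"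
    "0 \<le> real_of_ereal (inverse p)" "real_of_ereal (inverse p) \<le> 1" by auto
qed

section \<open>The lazy walk matrix and the decay of its iterates\<close>

definition lazy_mat :: "real mat \<Rightarrow> real mat" where
  "lazy_mat M = (1/2) \<cdot>\<^sub>m (1\<^sub>m (dim_row M) + diag_powr M (-1) * adj_T M)"

text \<open>The \<open>l\<close>-th term of the series for \<open>x_star\<close> without its factor
  1/2. For RDDZ matrices, entry \<open>i\<close> is also the expected gain at time \<open>l\<close>
  of the walk started at \<open>i\<close>.\<close>

definition walk_iter :: "real mat \<Rightarrow> real Matrix.vec \<Rightarrow> nat \<Rightarrow> real Matrix.vec" where
  "walk_iter M b l = (lazy_mat M ^\<^sub>m l) *\<^sub>v (diag_powr M (-1) *\<^sub>v b)"

locale rddz =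
  fixes n :: nat and M :: "real mat"
  assumes RDDZ: "RDDZ n M"
begin

lemma M_carrier: "M \<in> carrier_mat n n" and M_dim [simp]: "dim_row M = n" "dim_col M = n"
  using RDDZ by (auto simp: RDDZ_def)

lemma diag_pos: "i < n \<Longrightarrow> 0 < M $$ (i, i)"
  using RDDZ by (auto simp: RDDZ_def)

lemma adj_T_carrier [simp]: "adj_T M \<in> carrier_mat n n"
  using M_carrier by (auto simp: adj_T_def diag_part_def)

lemma diag_powr_carrier [simp]: "diag_powr M r \<in> carrier_mat n n"
  by (simp add: diag_powr_def)

lemma adj_T_entry: "i < n \<Longrightarrow> j < n \<Longrightarrow> adj_T M $$ (i, j) = (if i = j then 0 else - M $$ (i, j))"
  by (simp add: adj_T_def diag_part_def)

lemma diag_inv_mult_vec: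
  "v \<in> carrier_vec n \<Longrightarrow> i < n \<Longrightarrow> (diag_powr M (-1) *\<^sub>v v) $ i = v $ i / M $$ (i, i)"
  using diag_pos[of i] by (simp add: diag_powr_mult_vec[OF M_carrier] powr_minus_divide)

lemma lazy_mat_carrier [simp]: "lazy_mat M \<in> carrier_mat n n"
  unfolding lazy_mat_def M_dim
  by (intro smult_carrier_mat add_carrier_mat mult_carrier_mat[OF diag_powr_carrier adj_T_carrier])

lemma diag_inv_adj_T_carrier: "diag_powr M (-1) * adj_T M \<in> carrier_mat n n"
  by (rule mult_carrier_mat[OF diag_powr_carrier adj_T_carrier])

lemma diag_inv_adj_T_entry:
  "i < n \<Longrightarrow> j < n \<Longrightarrow> (diag_powr M (-1) * adj_T M) $$ (i, j) = adj_T M $$ (i, j) / M $$ (i, i)"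
  using diag_pos[of i]
  by (simp add: diag_powr_mult_mat[OF M_carrier adj_T_carrier] powr_minus_divide del: index_mult_mat(1))

lemma lazy_mat_mult_vec:
  assumes "v \<in> carrier_vec n" "i < n"
  shows "(lazy_mat M *\<^sub>v v) $ i =
    1/2 * (v $ i + (\<Sum>j<n. adj_T M $$ (i, j) / M $$ (i, i) * v $ j))"
  unfolding lazy_mat_def M_dim half_add_mult_vec[OF diag_inv_adj_T_carrier assms]
  using assms diag_inv_adj_T_entry by simp

lemma pow_lazy_mat_carrier: "lazy_mat M ^\<^sub>m l \<in> carrier_mat n n"
  by (rule pow_carrier_mat[OF lazy_mat_carrier])

lemma diag_powr_mult_vec_carrier: "v \<in> carrier_vec n \<Longrightarrow> diag_powr M r *\<^sub>v v \<in> carrier_vec n"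
  by (rule mult_mat_vec_carrier[OF diag_powr_carrier])

lemma walk_iter_0:
  assumes "b \<in> carrier_vec n"
  shows "walk_iter M b 0 = diag_powr M (-1) *\<^sub>v b"
  unfolding walk_iter_def pow_mat.simps carrier_matD[OF lazy_mat_carrier]
  by (rule one_mult_mat_vec[OF diag_powr_mult_vec_carrier[OF assms]])

lemma walk_iter_Suc:
  assumes "b \<in> carrier_vec n"
  shows "walk_iter M b (Suc l) = lazy_mat M *\<^sub>v walk_iter M b l"
proof -
  note W = lazy_mat_carrier
  \<comment> \<open>\<open>pow_mat\<close> puts the new factor on the right, next to the vector,
    while the recursion needs it on the left.\<close>
  have *: "lazy_mat M ^\<^sub>m l * lazy_mat M = lazy_mat M * lazy_mat M ^\<^sub>m l"
  proof (induction l)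
    case 0
    show ?case
      unfolding pow_mat.simps carrier_matD[OF W] left_mult_one_mat[OF W] right_mult_one_mat[OF W] ..
  next
    case (Suc l)
    have "lazy_mat M ^\<^sub>m Suc l * lazy_mat M = (lazy_mat M * lazy_mat M ^\<^sub>m l) * lazy_mat M"
      unfolding pow_mat.simps Suc.IH ..
    also have "\<dots> = lazy_mat M * (lazy_mat M ^\<^sub>m l * lazy_mat M)"
      by (rule assoc_mult_mat[OF W pow_lazy_mat_carrier W])
    finally show ?case unfolding pow_mat.simps .
  qed
  show ?thesis
    unfolding walk_iter_def pow_mat.simps *
    by (rule assoc_mult_mat_vec[OF W pow_lazy_mat_carrier diag_powr_mult_vec_carrier[OF assms]])
qed

lemma walk_iter_carrier [simp]:
  assumes "b \<in> carrier_vec n"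
  shows "walk_iter M b l \<in> carrier_vec n"
  unfolding walk_iter_def
  by (rule mult_mat_vec_carrier[OF pow_lazy_mat_carrier diag_powr_mult_vec_carrier[OF assms]])

lemma walk_iter_Suc_entry:
  assumes "b \<in> carrier_vec n" "i < n"
  shows "walk_iter M b (Suc l) $ i =
    1/2 * (walk_iter M b l $ i + (\<Sum>j<n. adj_T M $$ (i, j) / M $$ (i, i) * walk_iter M b l $ j))"
  unfolding walk_iter_Suc[OF assms(1)]
  by (rule lazy_mat_mult_vec[OF walk_iter_carrier[OF assms(1)] assms(2)])

text \<open>With \<open>K = D^(-1) A^T\<close>, the start is
  \<open>D^(-1) b = D^(-1) M x = (I - K) x\<close>. As \<open>W = (I + K) / 2\<close> commutes with
  \<open>I - K\<close>, the range of \<open>I - K\<close> is invariant under \<open>W\<close>, and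
  \<open>W z\<close> is the next witness.\<close>

lemma walk_iter_range:
  assumes "b \<in> carrier_vec n" "b \<in> mat_range M"
  shows "\<exists>z. \<forall>i<n. walk_iter M b l $ i = z i - (\<Sum>j<n. adj_T M $$ (i, j) / M $$ (i, i) * z j)"
proof (induction l)
  case 0
  obtain x where x: "x \<in> carrier_vec n" "b = M *\<^sub>v x"
    using assms(2) by (auto simp: mat_range_def)
  have "walk_iter M b 0 $ i = x $ i - (\<Sum>j<n. adj_T M $$ (i, j) / M $$ (i, i) * x $ j)" if "i < n" for i
  proof -
    have "(\<Sum>j<n. adj_T M $$ (i, j) / M $$ (i, i) * x $ j) =
        (\<Sum>j<n. (if i = j then x $ j else 0) - M $$ (i, j) * x $ j / M $$ (i, i))"
      using that diag_pos[of i] by (intro sum.cong) (auto simp: adj_T_entry)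
    also have "\<dots> = x $ i - b $ i / M $$ (i, i)"
      using that x by (simp add: sum_subtractf scalar_prod_def atLeast0LessThan sum_divide_distrib)
    finally show ?thesis
      using that assms(1) by (simp add: walk_iter_0 diag_inv_mult_vec)
  qed
  then show ?case by (intro exI[of _ "\<lambda>j. x $ j"]) blast
next
  case (Suc l)
  let ?K = "\<lambda>i j. adj_T M $$ (i, j) / M $$ (i, i)"
  obtain z where z: "\<And>i. i < n \<Longrightarrow> walk_iter M b l $ i = z i - (\<Sum>j<n. ?K i j * z j)"
    using Suc by blast
  define Kz where "Kz = (\<lambda>i. \<Sum>j<n. ?K i j * z j)"
  have "walk_iter M b (Suc l) $ i =
      1/2 * (z i + Kz i) - (\<Sum>j<n. ?K i j * (1/2 * (z j + Kz j)))" if i: "i < n" for i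
  proof -
    have "walk_iter M b (Suc l) $ i = 1/2 * (z i - Kz i + (\<Sum>j<n. ?K i j * (z j - Kz j)))"
      using i assms(1) z by (simp add: walk_iter_Suc_entry Kz_def)
    also have "(\<Sum>j<n. ?K i j * (z j - Kz j)) = Kz i - (\<Sum>j<n. ?K i j * Kz j)"
      unfolding right_diff_distrib sum_subtractf by (simp add: Kz_def)
    also have "1/2 * (z i - Kz i + \<dots>) = 1/2 * (z i + Kz i) - 1/2 * (Kz i + (\<Sum>j<n. ?K i j * Kz j))"
      by (simp add: field_simps)
    also have "1/2 * (Kz i + (\<Sum>j<n. ?K i j * Kz j)) = 1/2 * (\<Sum>j<n. ?K i j * z j + ?K i j * Kz j)"
      unfolding sum.distrib by (simp add: Kz_def)
    also have "\<dots> = (\<Sum>j<n. ?K i j * (1/2 * (z j + Kz j)))"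
      unfolding sum_distrib_left by (intro sum.cong) (simp_all add: distrib_left mult.assoc)
    finally show ?thesis .
  qed
  then show ?case by (intro exI[of _ "\<lambda>i. 1/2 * (z i + Kz i)"]) blast
qed

lemma scaled_adj_T_carrier: "scaled_adj_T M p \<in> carrier_mat n n"
  unfolding scaled_adj_T_def
  by (intro mult_carrier_mat[of _ n n] adj_T_carrier diag_powr_carrier)

text \<open>Entrywise \<open>S D^(1/p) = D^(1/p) K\<close> with \<open>K = D^(-1) A^T\<close>: since
  \<open>1/q = 1 - 1/p\<close>, the left factor \<open>D^(-1/q)\<close> of \<open>S\<close> is
  \<open>D^(1/p) D^(-1)\<close>. So \<open>S\<close> is \<open>K\<close> conjugated by
  \<open>D^(1/p)\<close>, stated without inverses.\<close>

lemma scaled_adj_T_entry: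
  assumes "1 \<le> p" "i < n" "j < n"
  defines "\<alpha> \<equiv> real_of_ereal (inverse p)"
  shows "scaled_adj_T M p $$ (i, j) * M $$ (j, j) powr \<alpha> =
    M $$ (i, i) powr \<alpha> * (adj_T M $$ (i, j) / M $$ (i, i))"
proof -
  have *: "M $$ (i, i) powr (\<alpha> - 1) = M $$ (i, i) powr \<alpha> / M $$ (i, i)"
    using diag_pos[OF assms(2)] by (simp add: powr_diff)
  have "scaled_adj_T M p $$ (i, j) = M $$ (i, i) powr (\<alpha> - 1) * adj_T M $$ (i, j) * M $$ (j, j) powr (- \<alpha>)"
    unfolding scaled_adj_T_def conj_exponent_inverse(1)[OF assms(1)]
    using assms(2,3) mat_mult_diag_powr[OF M_carrier mult_carrier_mat[OF diag_powr_carrier adj_T_carrier], of i j]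
      diag_powr_mult_mat[OF M_carrier adj_T_carrier, of i j]
    by (simp add: \<alpha>_def del: index_mult_mat(1))
  then show ?thesis
    using diag_pos[OF assms(3)] by (simp add: * powr_minus field_simps)
qed

text \<open>In the coordinates \<open>u = D^(1/p) walk_iter\<close> the walk is iteration of the
  contracting matrix inside the range. Changing coordinates costs \<open>d powr \<alpha>\<close> at
  \<open>b\<close> and \<open>d powr (1 - \<alpha>)\<close> at \<open>t\<close>, together the single
  factor \<open>d_max M\<close>. The bound \<open>\<gamma> < 2\<close> holds because an operator
  norm is nonnegative.\<close>

lemma walk_iter_decay:
  assumes b: "b \<in> carrier_vec n" "b \<in> mat_range M" and t: "t \<in> carrier_vec n" and n: "0 < n"
    and \<gamma>: "0 < \<gamma>" "\<gamma> \<le> gamma_max M"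
  shows "\<gamma> < 2" and "(\<Sum>i<n. t $ i * walk_iter M b l $ i) \<le>
    d_max M * real (norm0 t) * pnorm \<infinity> (diag_powr M (-1) *\<^sub>v t)
       * real (norm0 b) * pnorm \<infinity> (diag_powr M (-1) *\<^sub>v b) * (1 - \<gamma> / 2) ^ l"
proof -
  let ?S = "\<lambda>p. (1/2) \<cdot>\<^sub>m (1\<^sub>m n + scaled_adj_T M p)"
  let ?U = "\<lambda>p. mat_range (1\<^sub>m n - scaled_adj_T M p)"
  \<comment> \<open>A supremum comes without an exponent that attains it. Giving up half of
    \<open>\<gamma>\<close> makes the inequality strict, so that some \<open>p\<close> satisfies
    it.\<close>
  have "\<gamma> / 2 < gamma_max M" using \<gamma> by simp
  then have "\<exists>x\<in>(\<lambda>p. 1 - restricted_opnorm p (?S p) (?U p)) ` {1..\<infinity>}. \<gamma> / 2 < x"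
    unfolding gamma_max_def M_dim by (intro less_cSupD) simp_all
  then obtain p where p: "1 \<le> p" and "\<gamma> / 2 < 1 - restricted_opnorm p (?S p) (?U p)"
    by auto
  then have \<rho>: "restricted_opnorm p (?S p) (?U p) < 1 - \<gamma> / 2" by simp
  define \<alpha> where "\<alpha> = real_of_ereal (inverse p)"
  have \<alpha>: "0 \<le> \<alpha>" "\<alpha> \<le> 1" using conj_exponent_inverse[OF p] by (auto simp: \<alpha>_def)
  note S = scaled_adj_T_carrier[of p]
  have Sc: "?S p \<in> carrier_mat n n" using S by auto
  have U: "?U p \<subseteq> carrier_vec n"
  proof
    fix v assume "v \<in> ?U p"
    then show "v \<in> carrier_vec n"
      unfolding mat_range_def using minus_carrier_mat[OF S] carrier_matD[OF S]
      by (auto intro!: mult_mat_vec_carrier)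
  qed
  define u where "u = (\<lambda>l. Matrix.vec n (\<lambda>i. M $$ (i, i) powr \<alpha> * walk_iter M b l $ i))"
  have uc: "u l \<in> carrier_vec n" for l by (simp add: u_def)
  have u_range: "u l \<in> ?U p" for l
  proof -
    obtain z where z: "\<And>i. i < n \<Longrightarrow>
        walk_iter M b l $ i = z i - (\<Sum>j<n. adj_T M $$ (i, j) / M $$ (i, i) * z j)"
      using walk_iter_range[OF b] by blast
    define y where "y = Matrix.vec n (\<lambda>j. M $$ (j, j) powr \<alpha> * z j)"
    have y: "y \<in> carrier_vec n" by (simp add: y_def)
    have "u l = (1\<^sub>m n - scaled_adj_T M p) *\<^sub>v y"
    proof (rule eq_vecI)
      fix i assume "i < dim_vec ((1\<^sub>m n - scaled_adj_T M p) *\<^sub>v y)"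
      then have i: "i < n" using S by simp
      have "(\<Sum>j<n. scaled_adj_T M p $$ (i, j) * y $ j) =
          (\<Sum>j<n. M $$ (i, i) powr \<alpha> * (adj_T M $$ (i, j) / M $$ (i, i) * z j))"
        using scaled_adj_T_entry[OF p i]
        by (intro sum.cong) (simp_all add: y_def \<alpha>_def mult.assoc[symmetric])
      then show "u l $ i = ((1\<^sub>m n - scaled_adj_T M p) *\<^sub>v y) $ i"
        unfolding one_minus_mult_vec[OF S y i] sum_distrib_left[symmetric]
        using i by (simp add: u_def y_def z right_diff_distrib)
    qed (use S in \<open>simp add: u_def\<close>)
    moreover have "y \<in> carrier_vec (dim_col (1\<^sub>m n - scaled_adj_T M p))" using S y by simp
    ultimately show ?thesis unfolding mat_range_def by blast
  qed
  have u_Suc: "?S p *\<^sub>v u l = u (Suc l)" for l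
  proof (rule eq_vecI)
    fix i assume "i < dim_vec (u (Suc l))"
    then have i: "i < n" by (simp add: u_def)
    have "(\<Sum>j<n. scaled_adj_T M p $$ (i, j) * u l $ j) =
        (\<Sum>j<n. M $$ (i, i) powr \<alpha> * (adj_T M $$ (i, j) / M $$ (i, i) * walk_iter M b l $ j))"
      using scaled_adj_T_entry[OF p i]
      by (intro sum.cong) (simp_all add: u_def \<alpha>_def mult.assoc[symmetric])
    then show "(?S p *\<^sub>v u l) $ i = u (Suc l) $ i"
      unfolding half_add_mult_vec[OF S uc i] sum_distrib_left[symmetric]
      using i b(1) by (simp add: u_def walk_iter_Suc_entry distrib_left)
  qed (use S in \<open>simp add: u_def\<close>)
  note op = restricted_opnorm_bound[OF p Sc n U u_range]
  show "\<gamma> < 2" using op(2) \<rho> by simp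
  then have q: "0 \<le> 1 - \<gamma> / 2" by simp
  have nn: "0 \<le> pnorm p (u l)" for l using n by (intro pnorm_nonneg) (simp add: u_def)
  have pn: "pnorm p (u l) \<le> (1 - \<gamma> / 2) ^ l * pnorm p (u 0)" for l
  proof (induction l)
    case (Suc l)
    have "pnorm p (u (Suc l)) \<le> restricted_opnorm p (?S p) (?U p) * pnorm p (u l)"
      using op(1)[of l] by (simp add: u_Suc)
    also have "\<dots> \<le> (1 - \<gamma> / 2) * pnorm p (u l)"
      using \<rho> nn by (intro mult_right_mono) auto
    also have "\<dots> \<le> (1 - \<gamma> / 2) * ((1 - \<gamma> / 2) ^ l * pnorm p (u 0))"
      using Suc q by (intro mult_left_mono) auto
    finally show ?case by (simp add: mult.assoc)
  qed simp
  define d where "d = d_max M"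
  have d: "M $$ (i, i) \<le> d" if "i < n" for i
    using that by (auto simp: d_def d_max_def)
  have d0: "0 < d" using d[OF n] diag_pos[OF n] by simp
  let ?nb = "pnorm \<infinity> (diag_powr M (-1) *\<^sub>v b)" and ?nt = "pnorm \<infinity> (diag_powr M (-1) *\<^sub>v t)"
  have le_inf: "\<bar>v $ i\<bar> / M $$ (i, i) \<le> pnorm \<infinity> (diag_powr M (-1) *\<^sub>v v)"
    if "v \<in> carrier_vec n" "i < n" for v i
  proof -
    have "i < dim_vec (diag_powr M (-1) *\<^sub>v v)"
      using that carrier_matD[OF diag_powr_carrier] by simp
    from abs_le_pnorm[OF _ this, of \<infinity>] show ?thesis
      using that diag_pos[of i] by (simp add: diag_inv_mult_vec abs_div del: index_mult_mat_vec)
  qed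
  have inf_nn: "0 \<le> pnorm \<infinity> (diag_powr M (-1) *\<^sub>v v)" if "v \<in> carrier_vec n" for v
    using n carrier_matD[OF diag_powr_carrier] by (intro pnorm_nonneg) simp
  have u0: "u 0 $ i = M $$ (i, i) powr \<alpha> * (b $ i / M $$ (i, i))" if "i < n" for i
    using that b by (simp add: u_def walk_iter_0 diag_inv_mult_vec del: index_mult_mat_vec)
  have "pnorm p (u 0) \<le> real (norm0 (u 0)) * (d powr \<alpha> * ?nb)"
  proof (rule pnorm_le_norm0[OF p])
    fix i assume "i < dim_vec (u 0)"
    then have i: "i < n" by (simp add: u_def)
    have "\<bar>u 0 $ i\<bar> = M $$ (i, i) powr \<alpha> * (\<bar>b $ i\<bar> / M $$ (i, i))"
      using diag_pos[OF i] by (simp add: u0[OF i] abs_mult abs_div)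
    also have "\<dots> \<le> d powr \<alpha> * ?nb"
      using d[OF i] diag_pos[OF i] \<alpha> le_inf[OF b(1) i]
      by (intro mult_mono powr_mono2) auto
    finally show "\<bar>u 0 $ i\<bar> \<le> d powr \<alpha> * ?nb" .
  qed (use n in \<open>simp add: u_def\<close>)
  also have "norm0 (u 0) = norm0 b"
  proof -
    have "{i. i < n \<and> u 0 $ i \<noteq> 0} = {i. i < n \<and> b $ i \<noteq> 0}"
      using u0 diag_pos by (intro Collect_cong conj_cong) (simp_all add: less_imp_neq[symmetric])
    then show ?thesis using b(1) uc[of 0] by (simp add: norm0_def)
  qed
  finally have pu0: "pnorm p (u 0) \<le> real (norm0 b) * (d powr \<alpha> * ?nb)" .
  have "(\<Sum>i<n. t $ i * walk_iter M b l $ i) = (\<Sum>i | i < n \<and> t $ i \<noteq> 0. t $ i * walk_iter M b l $ i)"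
    by (rule sum.mono_neutral_right) auto
  also have "\<dots> \<le> (\<Sum>i | i < n \<and> t $ i \<noteq> 0. d powr (1 - \<alpha>) * ?nt * pnorm p (u l))"
  proof (rule sum_mono)
    fix i assume "i \<in> {i. i < n \<and> t $ i \<noteq> 0}"
    then have i: "i < n" by simp
    \<comment> \<open>Split so that the last factor is \<open>u\<close> and the first ones contain
      \<open>t\<close> only through \<open>D^(-1) t\<close>, as in \<open>log_arg\<close>.\<close>
    have "t $ i * walk_iter M b l $ i = M $$ (i, i) powr (1 - \<alpha>) * (t $ i / M $$ (i, i)) * u l $ i"
      using i diag_pos[OF i] by (simp add: u_def powr_diff)
    also have "\<dots> \<le> \<bar>\<dots>\<bar>" by (rule abs_ge_self)
    also have "\<dots> = M $$ (i, i) powr (1 - \<alpha>) * (\<bar>t $ i\<bar> / M $$ (i, i)) * \<bar>u l $ i\<bar>"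
      using diag_pos[OF i] by (simp add: abs_mult abs_div)
    also have "\<dots> \<le> d powr (1 - \<alpha>) * ?nt * pnorm p (u l)"
      using d[OF i] diag_pos[OF i] \<alpha> le_inf[OF t i] i inf_nn[OF t]
      by (intro mult_mono powr_mono2 abs_le_pnorm[OF p]) (auto simp: u_def)
    finally show "t $ i * walk_iter M b l $ i \<le> d powr (1 - \<alpha>) * ?nt * pnorm p (u l)" .
  qed
  also have "\<dots> = real (norm0 t) * d powr (1 - \<alpha>) * ?nt * pnorm p (u l)"
    using t by (simp add: norm0_def)
  also have "\<dots> \<le> real (norm0 t) * d powr (1 - \<alpha>) * ?nt *
      ((1 - \<gamma> / 2) ^ l * (real (norm0 b) * (d powr \<alpha> * ?nb)))"
    using inf_nn[OF t] q
    by (intro mult_left_mono order_trans[OF pn] pu0) auto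
  also have "\<dots> = (d powr (1 - \<alpha>) * d powr \<alpha>) * real (norm0 t) * ?nt * real (norm0 b) * ?nb * (1 - \<gamma> / 2) ^ l"
    by (simp add: ac_simps)
  also have "d powr (1 - \<alpha>) * d powr \<alpha> = d"
    using d0 by (simp flip: powr_add)
  finally show "(\<Sum>i<n. t $ i * walk_iter M b l $ i) \<le>
    d_max M * real (norm0 t) * ?nt * real (norm0 b) * ?nb * (1 - \<gamma> / 2) ^ l"
    by (simp add: d_def)
qed

end

section \<open>Running time and failure probability of programs\<close>

text \<open>\<open>run\<close> appends steps at the end, but a program is analysed from its first
  instruction on.\<close>

lemma run_Suc_left: "run M b t P c (Suc k) = bind_pmf (step M b t P c) (\<lambda>c'. run M b t P c' k)"
proof (induction k)
  case 0
  then show ?case by (simp add: bind_return_pmf bind_return_pmf')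
next
  case (Suc k)
  have "run M b t P c (Suc (Suc k)) = bind_pmf (run M b t P c (Suc k)) (step M b t P)"
    by simp
  also have "\<dots> = bind_pmf (step M b t P c) (\<lambda>c'. run M b t P c' (Suc k))"
    unfolding Suc.IH bind_assoc_pmf by simp
  finally show ?case .
qed

text \<open>Partial sums of \<open>expected_time\<close>, arranged by the first step: an induction
  on the step bound then never has to presuppose termination.\<close>

primrec time_upto ::
  "real mat \<Rightarrow> real Matrix.vec \<Rightarrow> real Matrix.vec \<Rightarrow> (nat \<Rightarrow> real) \<Rightarrow> instr list \<Rightarrow> nat \<Rightarrow> config \<Rightarrow> ennreal"
where
  "time_upto M b t \<tau> P 0 c = 0"
| "time_upto M b t \<tau> P (Suc m) c = ennreal (step_time M \<tau> P c) +
     (\<integral>\<^sup>+ c'. time_upto M b t \<tau> P m c' \<partial>measure_pmf (step M b t P c))"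

lemma time_upto_eq_sum:
  "time_upto M b t \<tau> P m c =
     (\<Sum>k<m. \<integral>\<^sup>+ c'. ennreal (step_time M \<tau> P c') \<partial>measure_pmf (run M b t P c k))"
proof (induction m arbitrary: c)
  case (Suc m)
  show ?case
    by (simp add: Suc.IH sum.lessThan_Suc_shift run_Suc_left nn_integral_sum
        nn_integral_bind_pmf nn_integral_return_pmf del: run.simps(2) sum.lessThan_Suc)
qed simp

lemma time_upto_Suc_mono: "time_upto M b t \<tau> P m c \<le> time_upto M b t \<tau> P (Suc m) c"
  unfolding time_upto_eq_sum by simp

text \<open>Weakens the recursion to the same step bound on both sides, so that straight-line code
  can be traversed without counting down.\<close>

lemma time_upto_le_step:
  "time_upto M b t \<tau> P m c \<le> ennreal (step_time M \<tau> P c) +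
     (\<integral>\<^sup>+ c'. time_upto M b t \<tau> P m c' \<partial>measure_pmf (step M b t P c))"
  using time_upto_Suc_mono[of M b t \<tau> P m c] by simp

lemma time_upto_halted: "halted P c \<Longrightarrow> time_upto M b t \<tau> P m c = 0"
  by (induction m) (simp_all add: step_time_def step_def nn_integral_return_pmf)

lemma expected_time_leI:
  assumes "\<And>m. time_upto M b t \<tau> P m c \<le> X"
  shows "expected_time M b t \<tau> P c \<le> X"
  unfolding expected_time_def suminf_eq_SUP using assms
  by (intro SUP_least) (simp add: time_upto_eq_sum)

section \<open>Failure probability as a decreasing limit\<close>

definition miss_set :: "instr list \<Rightarrow> real set \<Rightarrow> config set" where
  "miss_set P S = {c. \<not> (halted P c \<and> snd (snd c) 0 \<in> S)}"

text \<open>The complement of \<open>output_prob\<close>; a run that never halts stays in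
  \<open>miss_set\<close>. Taken in \<open>ennreal\<close>, so that it can be integrated like the
  running time.\<close>

definition miss_prob ::
  "real mat \<Rightarrow> real Matrix.vec \<Rightarrow> real Matrix.vec \<Rightarrow> instr list \<Rightarrow> real set \<Rightarrow> config \<Rightarrow> ennreal"
where
  "miss_prob M b t P S c = (INF k. emeasure (measure_pmf (run M b t P c k)) (miss_set P S))"

lemma emeasure_bind_pmf_eq:
  "emeasure (measure_pmf (bind_pmf p f)) A = (\<integral>\<^sup>+ x. emeasure (measure_pmf (f x)) A \<partial>measure_pmf p)"
  by (simp add: nn_integral_bind_pmf flip: nn_integral_indicator)

text \<open>A halted configuration is a fixed point of \<open>step\<close>, so a success is never
  lost again.\<close>

lemma decseq_miss: "decseq (\<lambda>k. emeasure (measure_pmf (run M b t P c k)) (miss_set P S))"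
proof (rule decseq_SucI)
  fix k
  have "emeasure (measure_pmf (step M b t P c')) (miss_set P S) \<le> indicator (miss_set P S) c'" for c'
    by (cases "c' \<in> miss_set P S")
      (auto simp: measure_pmf.emeasure_le_1 step_def miss_set_def)
  then have "emeasure (measure_pmf (run M b t P c (Suc k))) (miss_set P S)
      \<le> (\<integral>\<^sup>+ c'. indicator (miss_set P S) c' \<partial>measure_pmf (run M b t P c k))"
    by (simp add: emeasure_bind_pmf_eq nn_integral_mono del: nn_integral_indicator)
  then show "emeasure (measure_pmf (run M b t P c (Suc k))) (miss_set P S)
      \<le> emeasure (measure_pmf (run M b t P c k)) (miss_set P S)"
    by simp
qed

text \<open>Condition on the first step and exchange infimum and integral; for a decreasing sequence
  this needs a finite integral, and probabilities are at most 1. The right side is the infimum over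
  runs of length at least 1, hence not smaller.\<close>

lemma miss_prob_step:
  "miss_prob M b t P S c \<le> (\<integral>\<^sup>+ c'. miss_prob M b t P S c' \<partial>measure_pmf (step M b t P c))"
proof -
  have "(\<integral>\<^sup>+ c'. miss_prob M b t P S c' \<partial>measure_pmf (step M b t P c)) =
      (INF k. \<integral>\<^sup>+ c'. emeasure (measure_pmf (run M b t P c' k)) (miss_set P S)
        \<partial>measure_pmf (step M b t P c))"
    unfolding miss_prob_def
  proof (rule nn_integral_monotone_convergence_INF_decseq)
    show "decseq (\<lambda>k c'. emeasure (measure_pmf (run M b t P c' k)) (miss_set P S))"
      by (intro decseq_SucI le_funI decseq_SucD[OF decseq_miss])
    show "(\<integral>\<^sup>+ c'. emeasure (measure_pmf (run M b t P c' 0)) (miss_set P S)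
        \<partial>measure_pmf (step M b t P c)) < \<infinity>"
      by (rule le_less_trans[OF nn_integral_mono[of _ _ "\<lambda>_. 1"]])
        (auto intro: measure_pmf.emeasure_le_1 simp del: run.simps)
  qed simp
  also have "\<dots> = (INF k. emeasure (measure_pmf (run M b t P c (Suc k))) (miss_set P S))"
    by (simp add: run_Suc_left emeasure_bind_pmf_eq del: run.simps)
  also have "\<dots> \<ge> miss_prob M b t P S c"
    unfolding miss_prob_def by (intro INF_greatest INF_lower) simp
  finally show ?thesis .
qed

lemma miss_prob_le_1: "miss_prob M b t P S c \<le> 1"
  unfolding miss_prob_def by (rule INF_lower2[of 0]) (auto intro: measure_pmf.emeasure_le_1 simp del: run.simps)

lemma miss_prob_success: "halted P c \<Longrightarrow> snd (snd c) 0 \<in> S \<Longrightarrow> miss_prob M b t P S c = 0"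
  unfolding miss_prob_def
  by (rule order_antisym[OF INF_lower2[of 0]]) (auto simp: miss_set_def)

text \<open>Infimum and supremum are not compared directly: the slack \<open>e\<close> selects one
  finite run length, at which hit and miss are complementary events.\<close>

lemma output_prob_geI:
  assumes "miss_prob M b t P S c \<le> ennreal q" "0 \<le> q"
  shows "output_prob M b t P c S \<ge> 1 - q"
proof (rule field_le_epsilon)
  fix e :: real assume e: "0 < e"
  let ?G = "{c'. halted P c' \<and> snd (snd c') 0 \<in> S}"
  have "miss_prob M b t P S c < ennreal (q + e)"
    using assms e by (intro le_less_trans[OF assms(1)]) (simp add: ennreal_lessI)
  then obtain k where k: "emeasure (measure_pmf (run M b t P c k)) (miss_set P S) < ennreal (q + e)"
    unfolding miss_prob_def INF_less_iff by auto
  have "measure_pmf.prob (run M b t P c k) (miss_set P S) < q + e"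
    using k assms e by (simp add: measure_pmf.emeasure_eq_measure ennreal_less_iff del: ennreal_plus)
  moreover have "measure_pmf.prob (run M b t P c k) (miss_set P S) =
      1 - measure_pmf.prob (run M b t P c k) ?G"
    using measure_pmf.prob_compl[of ?G "run M b t P c k"]
    by (simp add: miss_set_def Compl_eq_Diff_UNIV[symmetric] Collect_neg_eq[symmetric])
  moreover have "measure_pmf.prob (run M b t P c k) ?G \<le> output_prob M b t P c S"
    unfolding output_prob_def by (intro cSUP_upper bdd_aboveI2[of _ _ 1]) auto
  ultimately show "1 - q \<le> output_prob M b t P c S + e" by simp
qed

section \<open>The program\<close>

text \<open>
  Real registers: 0 output, 1 to 5 the input of \<open>init_config\<close>, 6 the constant 1, 7 $1 - \gamma/2$,
  8 scratch, 9 the number $J$ of samples, 10 and 11 scratch, 12 the running sum, 13 the threshold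
  $\theta$. Natural registers: 1 the walk length $N$, 2 the current vertex, 3 the step counter,
  4 the constant 1. Lines 9 to 11 compute $N$, lines 18 to 28 draw samples, and lines 20 to 26 walk.
\<close>

definition estimator :: "instr list" where
  "estimator =
    [RConst 6 1,
     JumpRLess 1 6 3,
     JumpRLess 0 6 33,
     IConst 4 1,
     RConst 7 2, RDiv 7 2 7, RSub 7 6 7,
     RConst 8 4, RMul 8 8 5,
     RMul 8 8 7, IAdd 1 1 4, JumpRLess 6 8 9,
     ROfI 13 1, RMul 13 13 4, RDiv 13 13 1, RDiv 13 13 1, RConst 8 100, RMul 13 13 8,
     SampleT 2, IConst 3 0,
     GetB 10 2, GetDiag 11 2, RDiv 10 10 11, RAdd 12 12 10,
     WalkStep 2 2, IAdd 3 3 4, JumpILess 3 1 20,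
     RAdd 9 9 6, JumpRLess 12 13 18,
     RConst 8 2, RMul 9 9 8, RMul 13 13 3, RDiv 0 13 9]"

lemma length_estimator: "length estimator = 33"
  by (simp add: estimator_def)

text \<open>Exactly what the instructions compute. At the absorbing value \<open>n\<close> both
  reads give 0 and \<open>0 / 0 = 0\<close>, so the program needs no test for termination of the
  walk.\<close>

definition walk_gain :: "real mat \<Rightarrow> real Matrix.vec \<Rightarrow> nat \<Rightarrow> real" where
  "walk_gain M b v = (if v < dim_vec b then b $ v else 0) / (if v < dim_row M then M $$ (v, v) else 0)"

text \<open>The gain is collected before the step, as in the program: \<open>r\<close> vertices are
  counted, and the vertex reached by the last step is never read.\<close>

primrec walk_sum :: "real mat \<Rightarrow> real Matrix.vec \<Rightarrow> nat \<Rightarrow> nat \<Rightarrow> real pmf" where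
  "walk_sum M b 0 v = return_pmf 0"
| "walk_sum M b (Suc r) v =
     bind_pmf (walk_step M v) (\<lambda>u. map_pmf ((+) (walk_gain M b v)) (walk_sum M b r u))"

definition sample_sum :: "real mat \<Rightarrow> real Matrix.vec \<Rightarrow> real Matrix.vec \<Rightarrow> nat \<Rightarrow> real pmf" where
  "sample_sum M b t N = bind_pmf (t_distr t) (walk_sum M b N)"

text \<open>Vertex and step counter are left out, so that the same invariant serves inside the walk
  and between samples.\<close>

definition loop_inv ::
  "nat \<Rightarrow> real \<Rightarrow> real \<Rightarrow> nat \<Rightarrow> real \<Rightarrow> (nat \<Rightarrow> nat) \<Rightarrow> (nat \<Rightarrow> real) \<Rightarrow> bool" where
  "loop_inv N \<Lambda> \<theta> J s I R \<longleftrightarrow> I 1 = N \<and> I 4 = 1 \<and> R 3 = \<Lambda> \<and> R 6 = 1 \<and> R 9 = real J \<and>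
     R 12 = s \<and> R 13 = \<theta>"

text \<open>
  Both the expected running time up to a step bound (\<open>w = 1\<close>) and the failure probability (\<open>w = 0\<close>)
  are such functionals, so the program is traversed only once. For the running time, \<open>F'\<close> is the
  functional with one more step, which drives the induction over the outer loop.
\<close>

locale cost_functional =
  fixes M :: "real mat" and b t :: "real Matrix.vec" and \<tau> :: "nat \<Rightarrow> real"
    and F F' :: "config \<Rightarrow> ennreal" and w :: ennreal and f :: real
  assumes F_step: "\<And>c. F c \<le> w * ennreal (step_time M \<tau> estimator c) +
      (\<integral>\<^sup>+ c'. F c' \<partial>measure_pmf (step M b t estimator c))"
    and F'_step: "\<And>c. F' c \<le> w * ennreal (step_time M \<tau> estimator c) +
      (\<integral>\<^sup>+ c'. F c' \<partial>measure_pmf (step M b t estimator c))"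
    and f_ge: "1 \<le> f" "\<And>v. v < dim_row M \<Longrightarrow> \<tau> v \<le> f"
begin

text \<open>Applied backwards, one instruction at a time; the successor \<open>c\<close> may stay
  schematic until simplification of the second premise computes it.\<close>

lemma F_det:
  assumes "pc < 33" "exec M b t (estimator ! pc) (pc, I, R) = return_pmf c"
    "instr_time M \<tau> (estimator ! pc) (pc, I, R) = 1" "F c \<le> X"
  shows "F (pc, I, R) \<le> w + X"
proof -
  have "F (pc, I, R) \<le> w + F c"
    using F_step[of "(pc, I, R)"] assms(1-3)
    by (simp add: step_def step_time_def halted_def length_estimator nn_integral_return_pmf)
  also have "\<dots> \<le> w + X"
    using assms(4) by (rule add_left_mono)
  finally show ?thesis .
qed

lemma w_times_3: "w + w + w = w * 3"
proof -
  have "w + w + w = w * (1 + 1 + 1)"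
    by (simp only: distrib_left mult_1_right)
  then show ?thesis by simp
qed

text \<open>A step from the absorbing value costs 1, which \<open>1 \<le> f\<close> covers; all
  others cost at most \<open>f\<close> by choice of \<open>f\<close>.\<close>

lemma F_walk:
  assumes "\<And>u. F (25, I(2 := u), R) \<le> X u"
  shows "F (24, I, R) \<le> w * f + (\<integral>\<^sup>+ u. X u \<partial>measure_pmf (walk_step M (I 2)))"
proof -
  have *: "estimator ! 24 = WalkStep 2 2" by (simp add: estimator_def)
  have "F (24, I, R) \<le> w * ennreal (if I 2 < dim_row M then \<tau> (I 2) else 1) +
      (\<integral>\<^sup>+ u. F (25, I(2 := u), R) \<partial>measure_pmf (walk_step M (I 2)))"
    using F_step[of "(24, I, R)"]
    by (simp add: step_def step_time_def halted_def length_estimator * del: fun_upd_apply)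
  also have "\<dots> \<le> w * f + (\<integral>\<^sup>+ u. X u \<partial>measure_pmf (walk_step M (I 2)))"
    using assms f_ge by (intro add_mono mult_left_mono nn_integral_mono ennreal_leI) auto
  finally show ?thesis .
qed

text \<open>Every iteration of the outer loop starts with this instruction. Spending the extra step
  of \<open>F'\<close> here, and nowhere else, lowers the step bound by one per sample.\<close>

lemma F'_sample:
  assumes "\<And>u. F (19, I(2 := u), R) \<le> X u"
  shows "F' (18, I, R) \<le> w + (\<integral>\<^sup>+ u. X u \<partial>measure_pmf (t_distr t))"
proof -
  have *: "estimator ! 18 = SampleT 2" by (simp add: estimator_def)
  have "F' (18, I, R) \<le> w + (\<integral>\<^sup>+ u. F (19, I(2 := u), R) \<partial>measure_pmf (t_distr t))"
    using F'_step[of "(18, I, R)"]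
    by (simp add: step_def step_time_def halted_def length_estimator * del: fun_upd_apply)
  also have "\<dots> \<le> w + (\<integral>\<^sup>+ u. X u \<partial>measure_pmf (t_distr t))"
    using assms by (intro add_mono nn_integral_mono) auto
  finally show ?thesis .
qed

text \<open>A pass consists of six unit instructions and one walk step, hence \<open>6 + f\<close>.
  The continuation bound \<open>H\<close> depends on the running sum only.\<close>

lemma F_inner_loop:
  assumes "loop_inv N \<Lambda> \<theta> J s I R" "I 3 + r = N" "0 < r"
    and H: "\<And>I R s. loop_inv N \<Lambda> \<theta> J s I R \<Longrightarrow> F (27, I, R) \<le> H s"
  shows "F (20, I, R) \<le> w * (real r * (6 + f)) +
    (\<integral>\<^sup>+ z. H (s + z) \<partial>measure_pmf (walk_sum M b r (I 2)))"
  using assms(1-3)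
proof (induction r arbitrary: I R s)
  case (Suc r)
  define s' where "s' = s + walk_gain M b (I 2)"
  define R' where "R' = R(10 := walk_gain M b (I 2), 11 := if I 2 < dim_row M then M $$ (I 2, I 2) else 0, 12 := s')"
  define X where "X = (\<lambda>u. w * (real r * (6 + f)) +
      (\<integral>\<^sup>+ z. H (s' + z) \<partial>measure_pmf (walk_sum M b r u)))"
  have X: "F (25, I(2 := u), R') \<le> w + (w + X u)" for u
  proof -
    let ?I = "I(2 := u, 3 := I 3 + 1)"
    have inv: "loop_inv N \<Lambda> \<theta> J s' ?I R'"
      using Suc.prems(1) by (simp add: loop_inv_def R'_def)
    have "F (if r = 0 then 27 else 20, ?I, R') \<le> X u"
    proof (cases "r = 0")
      case True
      then show ?thesis using H[OF inv] by (simp add: X_def nn_integral_return_pmf)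
    next
      case False
      then show ?thesis
        using Suc.IH[of s' ?I R'] inv Suc.prems(2) by (simp add: X_def fun_upd_def)
    qed
    then show ?thesis
      using Suc.prems
      by (intro F_det[where c = "(26, ?I, R')"] F_det[where c = "(if r = 0 then 27 else 20, ?I, R')"])
        (auto simp: estimator_def loop_inv_def)
  qed
  have "F (20, I, R) \<le> w + (w + (w + (w + (w * f +
      (\<integral>\<^sup>+ u. w + (w + X u) \<partial>measure_pmf (walk_step M (I 2)))))))"
    apply (rule F_det, simp, simp add: estimator_def, simp add: estimator_def)
    apply (rule F_det, simp, simp add: estimator_def, simp add: estimator_def)
    apply (rule F_det, simp, simp add: estimator_def, simp add: estimator_def)
    apply (rule F_det[where c = "(24, I, R')"], simp)
      subgoal using Suc.prems(1)
        by (auto simp: estimator_def R'_def s'_def walk_gain_def loop_inv_def fun_eq_iff)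
     apply (simp add: estimator_def)
    apply (rule F_walk, rule X)
    done
  also have "(\<integral>\<^sup>+ u. w + (w + X u) \<partial>measure_pmf (walk_step M (I 2))) =
      w + (w + (w * (real r * (6 + f)) + (\<integral>\<^sup>+ z. H (s + z) \<partial>measure_pmf (walk_sum M b (Suc r) (I 2)))))"
    by (simp add: nn_integral_add X_def s'_def add.assoc nn_integral_bind_pmf)
  also have "w + (w + (w + (w + (w * f + \<dots>)))) = w * (6 + f) + w * (real r * (6 + f)) +
      (\<integral>\<^sup>+ z. H (s + z) \<partial>measure_pmf (walk_sum M b (Suc r) (I 2)))"
  proof -
    have "w * (6 + f) = w * 3 + w * 3 + w * f"
      using f_ge(1) distrib_left[of w 3 3] by (simp add: distrib_left)
    then show ?thesis by (simp add: ac_simps flip: w_times_3)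
  qed
  also have "w * (6 + f) + w * (real r * (6 + f)) = w * (real (Suc r) * (6 + f))"
    using f_ge(1) by (simp add: distrib_left[symmetric] ennreal_plus[symmetric] del: ennreal_plus)
      (simp add: algebra_simps)
  finally show ?case .
qed simp

text \<open>The 4 counts the sampling, the reset of the step counter, the sample count and the
  threshold test; \<open>h\<close> and \<open>g\<close> bound the continuations after going on and
  after stopping.\<close>

lemma F'_iteration:
  assumes inv: "loop_inv N \<Lambda> \<theta> J s I R" and "0 < N"
    and h: "\<And>I R s. loop_inv N \<Lambda> \<theta> (Suc J) s I R \<Longrightarrow> s < \<theta> \<Longrightarrow> F (18, I, R) \<le> h s"
    and g: "\<And>I R s. loop_inv N \<Lambda> \<theta> (Suc J) s I R \<Longrightarrow> \<not> s < \<theta> \<Longrightarrow> F (29, I, R) \<le> g"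
  shows "F' (18, I, R) \<le> w * (real N * (6 + f) + 4) +
    (\<integral>\<^sup>+ z. (if s + z < \<theta> then h (s + z) else g) \<partial>measure_pmf (sample_sum M b t N))"
proof -
  let ?H = "\<lambda>s. if s < \<theta> then h s else g"
  have *: "F (27, I, R) \<le> w + (w + ?H s)" if "loop_inv N \<Lambda> \<theta> J s I R" for I R s
  proof -
    have inv: "loop_inv N \<Lambda> \<theta> (Suc J) s I (R(9 := real (Suc J)))"
      using that by (simp add: loop_inv_def)
    show ?thesis
      using h[OF inv] g[OF inv] that
      by (intro F_det[where c = "(28, I, R(9 := real (Suc J)))"]
          F_det[where c = "(if s < \<theta> then 18 else 29, I, R(9 := real (Suc J)))"])
        (auto simp: estimator_def loop_inv_def)
  qed
  have "F (19, I(2 := u), R) \<le> w + (w * (real N * (6 + f)) +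
      (\<integral>\<^sup>+ z. w + (w + ?H (s + z)) \<partial>measure_pmf (walk_sum M b N u)))" for u
  proof (rule F_det)
    show "F (20, I(2 := u, 3 := 0), R) \<le> w * (real N * (6 + f)) +
      (\<integral>\<^sup>+ z. w + (w + ?H (s + z)) \<partial>measure_pmf (walk_sum M b N u))"
      using F_inner_loop[of N \<Lambda> \<theta> J s "I(2 := u, 3 := 0)" R N "\<lambda>s. w + (w + ?H s)"] * inv \<open>0 < N\<close>
      by (simp add: loop_inv_def)
  qed (simp_all add: estimator_def)
  from F'_sample[OF this]
  have "F' (18, I, R) \<le> w + (w + (w * (real N * (6 + f)) + (w + (w +
     (\<integral>\<^sup>+ z. ?H (s + z) \<partial>measure_pmf (sample_sum M b t N))))))"
    by (simp add: nn_integral_add add.assoc sample_sum_def nn_integral_bind_pmf)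
  also have "\<dots> = (w * (real N * (6 + f)) + (w + w + w + w)) +
      (\<integral>\<^sup>+ z. ?H (s + z) \<partial>measure_pmf (sample_sum M b t N))"
    by (simp add: ac_simps)
  also have "w * (real N * (6 + f)) + (w + w + w + w) = w * (real N * (6 + f) + 4)"
  proof -
    have "ennreal (real N * (6 + f) + 4) = ennreal (real N * (6 + f)) + 4"
      using f_ge(1) by (subst ennreal_plus) simp_all
    moreover have "w + w + w + w = w * 4"
      using w_times_3 distrib_left[of w 3 1] by simp
    ultimately show ?thesis by (simp add: distrib_left)
  qed
  finally show ?thesis .
qed

text \<open>\<open>\<theta> / J\<close> estimates the mean of a sample; the remaining factor
  \<open>\<Lambda> / 2\<close> undoes the normalization of \<open>t\<close> and restores the 1/2 in
  front of the series.\<close>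

lemma F_finish:
  assumes "loop_inv N \<Lambda> \<theta> J s I R"
    and "\<And>I R. R 0 = \<theta> * \<Lambda> / (real J * 2) \<Longrightarrow> F (33, I, R) \<le> X"
  shows "F (29, I, R) \<le> w * 4 + X"
proof -
  have "F (29, I, R) \<le> w + (w + (w + (w + X)))"
    apply (rule F_det, simp, simp add: estimator_def, simp add: estimator_def)
    apply (rule F_det, simp, simp add: estimator_def, simp add: estimator_def)
    apply (rule F_det, simp, simp add: estimator_def, simp add: estimator_def)
    apply (rule F_det, simp, simp add: estimator_def, simp add: estimator_def)
    apply (rule assms(2))
    using assms(1) by (simp add: loop_inv_def)
  also have "\<dots> = w * (1 + 1 + 1 + 1) + X"
    by (simp only: distrib_left mult_1_right add.assoc)
  finally show ?thesis by simp
qed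

text \<open>Each factor \<open>q\<close> costs three instructions. The loop multiplies before it
  tests, so it returns the first exponent at which the product is at most 1 only if that exponent is
  positive; hence \<open>0 < r\<close>.\<close>

lemma F_count_loop:
  assumes c: "\<And>i. i < N \<Longrightarrow> 1 < x * q ^ i" "x * q ^ N \<le> 1"
    and "I 1 + r = N" "0 < r" "I 4 = 1" "R 6 = 1" "R 7 = q" "R 8 = x * q ^ I 1"
    and X: "\<And>I' y. I' 1 = N \<Longrightarrow> I' 4 = 1 \<Longrightarrow> F (12, I', R(8 := y)) \<le> X"
  shows "F (9, I, R) \<le> w * (real r * 3) + X"
  using assms(3-)
proof (induction r arbitrary: I R)
  case (Suc r)
  let ?R = "R(8 := x * q ^ Suc (I 1))" and ?I = "I(1 := I 1 + 1)"
  have "F (if r = 0 then 12 else 9, ?I, ?R) \<le> w * (real r * 3) + X"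
  proof (cases "r = 0")
    case True
    then show ?thesis
      using Suc.prems(7)[of ?I "x * q ^ Suc (I 1)"] Suc.prems(1,3) by (simp add: fun_upd_def)
  next
    case False
    have "F (9, ?I, ?R) \<le> w * (real r * 3) + X"
    proof (rule Suc.IH)
      show "F (12, I', ?R(8 := y)) \<le> X" if "I' 1 = N" "I' 4 = 1" for I' y
        unfolding fun_upd_upd using that by (rule Suc.prems(7))
    qed (use False Suc.prems(1-6) in auto)
    with False show ?thesis by simp
  qed
  moreover have "(1 < x * q ^ Suc (I 1)) = (r \<noteq> 0)"
    using c(1)[of "Suc (I 1)"] c(2) Suc.prems(1) by (cases "r = 0") auto
  ultimately have "F (9, I, R) \<le> w + (w + (w + (w * (real r * 3) + X)))"
    using Suc.prems
    by (intro F_det[where c = "(10, I, ?R)"] F_det[where c = "(11, ?I, ?R)"]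
        F_det[where c = "(if r = 0 then 12 else 9, ?I, ?R)"])
      (auto simp: estimator_def ac_simps)
  also have "\<dots> = w * 3 + w * (real r * 3) + X"
    by (simp add: ac_simps flip: w_times_3)
  also have "w * 3 + w * (real r * 3) = w * (real (Suc r) * 3)"
    using ennreal_plus[of 3 "real r * 3"]
    by (simp add: distrib_left[symmetric] del: ennreal_plus)
  finally show ?case .
qed simp

text \<open>Of the 14 unit instructions, eight precede the counting loop and six compute the
  threshold after it.\<close>

lemma F_init:
  assumes c: "\<And>i. i < N \<Longrightarrow> 1 < 4 * B * (1 - \<gamma> / 2) ^ i" "4 * B * (1 - \<gamma> / 2) ^ N \<le> 1"
    and "0 < N" "\<epsilon> < 1"
    and X: "\<And>I R. loop_inv N (pnorm 1 t)
        (real N * pnorm \<infinity> (diag_powr M (-1) *\<^sub>v b) / \<epsilon> / \<epsilon> * 100) 0 0 I R \<Longrightarrow> F (18, I, R) \<le> X"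
  shows "F (init_config M b t \<epsilon> \<gamma> B) \<le> w * (14 + real N * 3) + X"
proof -
  have "F (init_config M b t \<epsilon> \<gamma> B) \<le> w + (w + (w + (w + (w + (w + (w + (w + (w * (real N * 3) +
     (w + (w + (w + (w + (w + (w + X))))))))))))))"
    unfolding init_config_def
    apply (rule F_det, simp, simp add: estimator_def, simp add: estimator_def)
    apply (rule F_det, simp, simp add: estimator_def \<open>\<epsilon> < 1\<close>, simp add: estimator_def)
    apply (rule F_det, simp, simp add: estimator_def, simp add: estimator_def)
    apply (rule F_det, simp, simp add: estimator_def, simp add: estimator_def)
    apply (rule F_det, simp, simp add: estimator_def, simp add: estimator_def)
    apply (rule F_det, simp, simp add: estimator_def, simp add: estimator_def)
    apply (rule F_det, simp, simp add: estimator_def, simp add: estimator_def)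
    apply (rule F_det, simp, simp add: estimator_def, simp add: estimator_def)
    apply (rule F_count_loop[OF c], assumption)
          using \<open>0 < N\<close> apply simp_all[7]
    apply (rule F_det, simp, simp add: estimator_def, simp add: estimator_def)
    apply (rule F_det, simp, simp add: estimator_def, simp add: estimator_def)
    apply (rule F_det, simp, simp add: estimator_def, simp add: estimator_def)
    apply (rule F_det, simp, simp add: estimator_def, simp add: estimator_def)
    apply (rule F_det, simp, simp add: estimator_def, simp add: estimator_def)
    apply (rule F_det, simp, simp add: estimator_def, simp add: estimator_def)
    apply (rule X)
    apply (simp add: loop_inv_def)
    done
  also have "\<dots> = w * (1+1+1+1+1+1+1+1+1+1+1+1+1+1) + w * (real N * 3) + X"
    by (simp only: distrib_left mult_1_right mult_1_left ac_simps)
  also have "w * (1+1+1+1+1+1+1+1+1+1+1+1+1+1) + w * (real N * 3) = w * (14 + real N * 3)"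
    using ennreal_plus[of 14 "real N * 3"]
    by (simp add: distrib_left[symmetric] del: ennreal_plus)
  finally show ?thesis .
qed

text \<open>Register 0 still holds 0, so the comparison of it with the constant 1 acts as an
  unconditional exit with output 0.\<close>

lemma F_init_coarse:
  assumes "1 \<le> \<epsilon>" and X: "\<And>I R. R 0 = 0 \<Longrightarrow> F (33, I, R) \<le> X"
  shows "F (init_config M b t \<epsilon> \<gamma> B) \<le> w * 3 + X"
proof -
  have "F (init_config M b t \<epsilon> \<gamma> B) \<le> w + (w + (w + X))"
    unfolding init_config_def
    apply (rule F_det, simp, simp add: estimator_def, simp add: estimator_def)
    apply (rule F_det, simp, simp add: estimator_def, simp add: estimator_def)
    using assms(1) apply simp
    apply (rule F_det, simp, simp add: estimator_def, simp add: estimator_def)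
    apply (rule X)
    apply simp
    done
  also have "\<dots> = w * 3 + X"
    by (simp add: ac_simps flip: w_times_3)
  finally show ?thesis .
qed

end

section \<open>The distribution of a sample\<close>

lemma pmf_embed_pmf_finite:
  assumes "\<And>x. 0 \<le> f x" "finite A" "\<And>x. x \<notin> A \<Longrightarrow> f x = 0" "sum f A = 1"
  shows "pmf (embed_pmf f) x = f x"
proof (rule pmf_embed_pmf)
  have "(\<integral>\<^sup>+ x. ennreal (f x) \<partial>count_space UNIV) = (\<Sum>x\<in>A. ennreal (f x))"
    using assms by (intro nn_integral_count_space'[where f = "\<lambda>x. ennreal (f x)" and A = A]) auto
  then show "(\<integral>\<^sup>+ x. ennreal (f x) \<partial>count_space UNIV) = 1"
    using assms by simp
qed (rule assms)

lemma expectation_bind_finite: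
  fixes h :: "'b \<Rightarrow> real"
  assumes "finite (set_pmf p)" "\<And>x. x \<in> set_pmf p \<Longrightarrow> finite (set_pmf (f x))"
  shows "measure_pmf.expectation (bind_pmf p f) h =
    measure_pmf.expectation p (\<lambda>x. measure_pmf.expectation (f x) h)"
  using assms
  by (simp add: pmf_expectation_bind[where A = "set_pmf p"] integral_measure_pmf[where A = "set_pmf p"])

context rddz
begin

lemma adj_T_nonneg: "i < n \<Longrightarrow> j < n \<Longrightarrow> 0 \<le> adj_T M $$ (i, j)"
  using RDDZ by (auto simp: adj_T_entry RDDZ_def)

lemma lazy_mat_entry:
  "i < n \<Longrightarrow> j < n \<Longrightarrow> lazy_mat M $$ (i, j) =
    1/2 * ((if i = j then 1 else 0) + adj_T M $$ (i, j) / M $$ (i, i))"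
  using carrier_matD[OF diag_inv_adj_T_carrier] diag_inv_adj_T_entry[of i j]
  unfolding lazy_mat_def M_dim by (simp del: index_mult_mat)

text \<open>The sign condition of RDDZ makes the walk offered by the access model the one that
  generates the series for \<open>x_star\<close>; no signs have to be carried along a walk.\<close>

lemma walk_mat_eq_lazy_mat: "walk_mat M = lazy_mat M"
proof -
  have "map_mat abs (adj_T M) = adj_T M"
    using carrier_matD[OF adj_T_carrier] adj_T_nonneg by (intro eq_matI) simp_all
  then show ?thesis by (simp add: walk_mat_def lazy_mat_def)
qed

lemma lazy_mat_nonneg: "i < n \<Longrightarrow> j < n \<Longrightarrow> 0 \<le> lazy_mat M $$ (i, j)"
  using adj_T_nonneg[of i j] diag_pos[of i] by (simp add: lazy_mat_entry)

lemma lazy_mat_row_sum: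
  assumes "i < n"
  shows "(\<Sum>j<n. lazy_mat M $$ (i, j)) \<le> 1"
proof -
  have "(\<Sum>j<n. lazy_mat M $$ (i, j)) =
      (\<Sum>j<n. 1/2 * ((if i = j then 1 else 0) + adj_T M $$ (i, j) / M $$ (i, i)))"
    using assms by (intro sum.cong) (simp_all add: lazy_mat_entry)
  also have "\<dots> = 1/2 * (1 + (\<Sum>j<n. adj_T M $$ (i, j)) / M $$ (i, i))"
    unfolding sum_distrib_left[symmetric] sum.distrib sum_divide_distrib[symmetric] using assms by simp
  also have "(\<Sum>j<n. adj_T M $$ (i, j)) = (\<Sum>j\<in>{..<n} - {i}. \<bar>M $$ (i, j)\<bar>)"
    using assms RDDZ
    by (intro sum.mono_neutral_cong_right) (auto simp: adj_T_entry RDDZ_def abs_of_nonpos)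
  also have "1/2 * (1 + \<dots> / M $$ (i, i)) \<le> 1/2 * (1 + 1)"
    using assms RDDZ by (intro mult_left_mono add_left_mono) (auto simp: RDDZ_def)
  finally show ?thesis by simp
qed

lemma pmf_walk_step:
  assumes "v < n"
  shows "pmf (walk_step M v) w = (if w < n then lazy_mat M $$ (v, w)
    else if w = n then 1 - (\<Sum>k<n. lazy_mat M $$ (v, k)) else 0)"
proof -
  let ?f = "\<lambda>w. if w < n then lazy_mat M $$ (v, w)
    else if w = n then 1 - (\<Sum>k<n. lazy_mat M $$ (v, k)) else 0"
  have "pmf (embed_pmf ?f) w = ?f w"
  proof (rule pmf_embed_pmf_finite[where A = "{..<Suc n}"])
    show "0 \<le> ?f w" for w
      using assms lazy_mat_nonneg lazy_mat_row_sum by auto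
    have "(\<Sum>w<n. ?f w) = (\<Sum>k<n. lazy_mat M $$ (v, k))" by (rule sum.cong) auto
    then show "sum ?f {..<Suc n} = 1" by simp
  qed auto
  then show ?thesis
    unfolding walk_step_def Let_def M_dim walk_mat_eq_lazy_mat using assms by simp
qed

lemma set_walk_step: "v \<le> n \<Longrightarrow> set_pmf (walk_step M v) \<subseteq> {..n}"
proof (cases "v < n")
  case True
  then show ?thesis by (auto simp: set_pmf_eq pmf_walk_step split: if_splits)
qed (auto simp: walk_step_def)

lemma expectation_walk_step:
  assumes "v < n" "h n = 0"
  shows "measure_pmf.expectation (walk_step M v) h = (\<Sum>w<n. lazy_mat M $$ (v, w) * h w)"
proof -
  have "measure_pmf.expectation (walk_step M v) h = (\<Sum>w<n. h w * pmf (walk_step M v) w)"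
    using assms set_walk_step[of v] by (intro integral_measure_pmf_real) (force simp: le_less)+
  then show ?thesis using assms(1) by (simp add: pmf_walk_step mult.commute)
qed

context
  fixes b :: "real Matrix.vec"
  assumes b: "b \<in> carrier_vec n" "\<And>i. i < n \<Longrightarrow> 0 \<le> b $ i" and n_pos: "0 < n"
begin

lemma walk_gain_eq: "walk_gain M b v = (if v < n then walk_iter M b 0 $ v else 0)"
  using b(1) by (simp add: walk_gain_def walk_iter_0 diag_inv_mult_vec del: index_mult_mat_vec)

lemma walk_gain_nonneg: "0 \<le> walk_gain M b v"
  using b diag_pos[of v] by (auto simp: walk_gain_def intro!: divide_nonneg_pos)

lemma walk_gain_le: "walk_gain M b v \<le> pnorm \<infinity> (diag_powr M (-1) *\<^sub>v b)"
proof (cases "v < n")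
  case True
  have "v < dim_vec (diag_powr M (-1) *\<^sub>v b)"
    using True carrier_matD[OF diag_powr_carrier] by simp
  from abs_le_pnorm[OF _ this, of \<infinity>] have "\<bar>walk_gain M b v\<bar> \<le> pnorm \<infinity> (diag_powr M (-1) *\<^sub>v b)"
    using True b(1) by (simp add: walk_gain_eq walk_iter_0 del: index_mult_mat_vec)
  then show ?thesis by simp
next
  case False
  then show ?thesis
    using n_pos carrier_matD[OF diag_powr_carrier] by (simp add: walk_gain_eq pnorm_nonneg)
qed

lemma walk_iter_nonneg: "i < n \<Longrightarrow> 0 \<le> walk_iter M b l $ i"
proof (induction l arbitrary: i)
  case 0
  then show ?case using b diag_pos[of i] by (simp add: walk_iter_0 diag_inv_mult_vec del: index_mult_mat_vec)
next
  case (Suc l)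
  then show ?case
    using b(1) diag_pos[of i] adj_T_nonneg[of i]
    by (simp add: walk_iter_Suc_entry) (intro add_nonneg_nonneg sum_nonneg divide_nonneg_pos mult_nonneg_nonneg; simp)
qed

lemma walk_iter_Suc_sum:
  assumes "v < n"
  shows "walk_iter M b (Suc l) $ v = (\<Sum>w<n. lazy_mat M $$ (v, w) * walk_iter M b l $ w)"
  using assms carrier_matD[OF lazy_mat_carrier] carrier_vecD[OF walk_iter_carrier[OF b(1), of l]]
  by (simp add: walk_iter_Suc[OF b(1)] scalar_prod_def atLeast0LessThan)

text \<open>Finite support makes every function integrable, and the range supplies the constant
  \<open>K\<close> of the stopping rule.\<close>

lemma walk_sum_support:
  "v \<le> n \<Longrightarrow> finite (set_pmf (walk_sum M b N v)) \<and>
    set_pmf (walk_sum M b N v) \<subseteq> {0..real N * pnorm \<infinity> (diag_powr M (-1) *\<^sub>v b)}"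
proof (induction N arbitrary: v)
  case (Suc N)
  have fin: "finite (set_pmf (walk_step M v))"
    using set_walk_step[OF Suc.prems] by (rule finite_subset) simp
  have "0 \<le> walk_gain M b v + z \<and> walk_gain M b v + z \<le> real (Suc N) * pnorm \<infinity> (diag_powr M (-1) *\<^sub>v b)"
    if "u \<in> set_pmf (walk_step M v)" "z \<in> set_pmf (walk_sum M b N u)" for u z
  proof -
    have "u \<le> n" using that set_walk_step[OF Suc.prems] by auto
    with Suc.IH that(2) have "0 \<le> z" "z \<le> real N * pnorm \<infinity> (diag_powr M (-1) *\<^sub>v b)" by force+
    then show ?thesis
      using walk_gain_nonneg[of v] walk_gain_le[of v] by (simp add: algebra_simps)
  qed
  then show ?case
    using fin Suc.IH set_walk_step[OF Suc.prems] by auto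
qed simp

text \<open>The gain at the starting vertex is the term \<open>l = 0\<close>. Averaging the
  remaining sum over one step applies \<open>W\<close> to each iterate and so shifts the index by
  one; the absorbing value contributes 0.\<close>

lemma expectation_walk_sum:
  "v \<le> n \<Longrightarrow> measure_pmf.expectation (walk_sum M b N v) (\<lambda>z. z) =
    (if v < n then \<Sum>l<N. walk_iter M b l $ v else 0)"
proof (induction N arbitrary: v)
  case (Suc N)
  let ?e = "\<lambda>v. if v < n then \<Sum>l<N. walk_iter M b l $ v else 0"
  have fin: "finite (set_pmf (walk_step M v))"
    using set_walk_step[OF Suc.prems] by (rule finite_subset) simp
  have sub: "u \<le> n" if "u \<in> set_pmf (walk_step M v)" for u
    using that set_walk_step[OF Suc.prems] by auto
  have "measure_pmf.expectation (walk_sum M b (Suc N) v) (\<lambda>z. z) =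
      measure_pmf.expectation (walk_step M v)
        (\<lambda>u. measure_pmf.expectation (walk_sum M b N u) (\<lambda>z. walk_gain M b v + z))"
    using fin sub walk_sum_support by (simp add: expectation_bind_finite)
  also have "\<dots> = measure_pmf.expectation (walk_step M v) (\<lambda>u. walk_gain M b v + ?e u)"
  proof (rule integral_cong_AE)
    show "AE u in measure_pmf (walk_step M v).
        measure_pmf.expectation (walk_sum M b N u) (\<lambda>z. walk_gain M b v + z) = walk_gain M b v + ?e u"
      using sub Suc.IH walk_sum_support
      by (auto simp: AE_measure_pmf_iff integrable_measure_pmf_finite)
  qed auto
  also have "\<dots> = walk_gain M b v + measure_pmf.expectation (walk_step M v) ?e"
    using fin by (simp add: integrable_measure_pmf_finite)
  also have "\<dots> = (if v < n then \<Sum>l<Suc N. walk_iter M b l $ v else 0)"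
  proof (cases "v < n")
    case True
    have "(\<Sum>w<n. lazy_mat M $$ (v, w) * ?e w) = (\<Sum>w<n. \<Sum>l<N. lazy_mat M $$ (v, w) * walk_iter M b l $ w)"
      by (intro sum.cong) (simp_all add: sum_distrib_left)
    also have "\<dots> = (\<Sum>l<N. walk_iter M b (Suc l) $ v)"
      unfolding walk_iter_Suc_sum[OF True] by (rule sum.swap)
    finally show ?thesis
      using True by (simp add: expectation_walk_step walk_gain_eq sum.lessThan_Suc_shift del: sum.lessThan_Suc)
  next
    case False
    then show ?thesis by (simp add: walk_gain_eq walk_step_def)
  qed
  finally show ?case .
qed simp

section \<open>Averaging over the starting vertex\<close>

context
  fixes t :: "real Matrix.vec"
  assumes t: "t \<in> carrier_vec n" "\<And>i. i < n \<Longrightarrow> 0 \<le> t $ i" "t \<noteq> 0\<^sub>v n"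
begin

lemma pnorm_1_eq: "pnorm 1 t = (\<Sum>i<n. t $ i)"
proof -
  have "0 \<le> (\<Sum>i<n. t $ i)" using t(2) by (intro sum_nonneg) auto
  then show ?thesis using t(1,2) by (simp add: pnorm_def)
qed

lemma pnorm_1_pos: "0 < pnorm 1 t"
proof -
  obtain i where i: "i < n" "t $ i \<noteq> 0" using t(1,3) by (metis eq_vecI carrier_vecD index_zero_vec)
  then have "0 < t $ i" using t(2)[of i] by simp
  then show ?thesis
    unfolding pnorm_1_eq using i(1) t(2) by (intro sum_pos2[of _ i]) auto
qed

lemma pmf_t_distr: "pmf (t_distr t) i = (if i < n then t $ i / pnorm 1 t else 0)"
proof -
  let ?f = "\<lambda>i. if i < n then t $ i / pnorm 1 t else 0"
  have "pmf (embed_pmf ?f) i = ?f i"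
  proof (rule pmf_embed_pmf_finite[where A = "{..<n}"])
    show "0 \<le> ?f i" for i using t(2) pnorm_1_pos by simp
    have "sum ?f {..<n} = (\<Sum>i<n. t $ i) / pnorm 1 t"
      unfolding sum_divide_distrib by (rule sum.cong) auto
    then show "sum ?f {..<n} = 1"
      using pnorm_1_pos by (simp add: pnorm_1_eq)
  qed auto
  then show ?thesis using t(1) by (simp add: t_distr_def)
qed

lemma set_t_distr: "set_pmf (t_distr t) \<subseteq> {..<n}"
  by (auto simp: set_pmf_eq pmf_t_distr split: if_splits)

lemma sample_sum_support:
  "finite (set_pmf (sample_sum M b t N))"
  "set_pmf (sample_sum M b t N) \<subseteq> {0..real N * pnorm \<infinity> (diag_powr M (-1) *\<^sub>v b)}"
proof -
  have fin: "finite (set_pmf (t_distr t))" using set_t_distr by (rule finite_subset) simp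
  have le: "u \<le> n" if "u \<in> set_pmf (t_distr t)" for u using that set_t_distr by force
  show "finite (set_pmf (sample_sum M b t N))"
    unfolding sample_sum_def set_bind_pmf using fin le walk_sum_support by blast
  show "set_pmf (sample_sum M b t N) \<subseteq> {0..real N * pnorm \<infinity> (diag_powr M (-1) *\<^sub>v b)}"
    unfolding sample_sum_def set_bind_pmf using le walk_sum_support by blast
qed

lemma expectation_sample_sum:
  "pnorm 1 t * measure_pmf.expectation (sample_sum M b t N) (\<lambda>z. z) =
    (\<Sum>l<N. \<Sum>i<n. t $ i * walk_iter M b l $ i)"
proof -
  have fin: "finite (set_pmf (t_distr t))" using set_t_distr by (rule finite_subset) simp
  have le: "u \<le> n" if "u \<in> set_pmf (t_distr t)" for u using that set_t_distr by force
  have "measure_pmf.expectation (sample_sum M b t N) (\<lambda>z. z) =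
      measure_pmf.expectation (t_distr t) (\<lambda>v. measure_pmf.expectation (walk_sum M b N v) (\<lambda>z. z))"
    unfolding sample_sum_def using fin le walk_sum_support by (intro expectation_bind_finite) auto
  also have "\<dots> = (\<Sum>v<n. measure_pmf.expectation (walk_sum M b N v) (\<lambda>z. z) * pmf (t_distr t) v)"
    using set_t_distr by (intro integral_measure_pmf_real) auto
  also have "\<dots> = (\<Sum>v<n. (\<Sum>l<N. t $ v * walk_iter M b l $ v) / pnorm 1 t)"
    by (intro sum.cong) (simp_all add: expectation_walk_sum pmf_t_distr sum_distrib_left sum_divide_distrib mult.commute)
  also have "\<dots> = (\<Sum>l<N. \<Sum>v<n. t $ v * walk_iter M b l $ v) / pnorm 1 t"
    unfolding sum_divide_distrib[symmetric] by (subst sum.swap) (rule refl)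
  finally show ?thesis using pnorm_1_pos by simp
qed

end

end

end

section \<open>The stopping rule\<close>

text \<open>The new summand is drawn first, so that the first sample can be split off in the order
  in which the loop draws it.\<close>

primrec iid_sum :: "real pmf \<Rightarrow> nat \<Rightarrow> real pmf" where
  "iid_sum Z 0 = return_pmf 0"
| "iid_sum Z (Suc m) = bind_pmf Z (\<lambda>z. map_pmf ((+) z) (iid_sum Z m))"

locale bounded_sample =
  fixes Z :: "real pmf" and K \<mu> :: real
  assumes finite_Z: "finite (set_pmf Z)" and Z_range: "set_pmf Z \<subseteq> {0..K}"
    and mean: "measure_pmf.expectation Z (\<lambda>z. z) = \<mu>"
begin

lemma finite_iid_sum: "finite (set_pmf (iid_sum Z m))"
  by (induction m) (use finite_Z in auto)

lemma iid_sum_nonneg: "s \<in> set_pmf (iid_sum Z m) \<Longrightarrow> 0 \<le> s"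
proof (induction m arbitrary: s)
  case (Suc m)
  then show ?case using Z_range by fastforce
qed simp

lemma Z_integrable: "integrable (measure_pmf Z) (f :: real \<Rightarrow> real)"
  by (rule integrable_measure_pmf_finite[OF finite_Z])

lemma mean_le: "\<mu> \<le> K"
proof -
  have "measure_pmf.expectation Z (\<lambda>z. z) \<le> measure_pmf.expectation Z (\<lambda>_. K)"
    using Z_range by (intro integral_mono_AE Z_integrable) (auto simp: AE_measure_pmf_iff)
  then show ?thesis by (simp add: mean)
qed

text \<open>On \<open>[0, K]\<close> one has \<open>z^2 \<le> K * z\<close>, which makes the square
  at most affine in \<open>z\<close>. A variance proportional to \<open>\<mu>\<close> is what lets
  order \<open>K / (\<epsilon>^2 * \<mu>)\<close> samples suffice.\<close>

lemma variance_le: "measure_pmf.expectation Z (\<lambda>z. (z - \<mu>)\<^sup>2) \<le> K * \<mu>"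
proof -
  have "measure_pmf.expectation Z (\<lambda>z. (z - \<mu>)\<^sup>2) \<le> measure_pmf.expectation Z (\<lambda>z. (K - 2 * \<mu>) * z + \<mu>\<^sup>2)"
  proof (intro integral_mono_AE Z_integrable)
    have "(z - \<mu>)\<^sup>2 \<le> (K - 2 * \<mu>) * z + \<mu>\<^sup>2" if "z \<in> set_pmf Z" for z
    proof -
      have "z * z \<le> K * z" using that Z_range by (intro mult_right_mono) auto
      then show ?thesis by (simp add: power2_eq_square algebra_simps)
    qed
    then show "AE z in measure_pmf Z. (z - \<mu>)\<^sup>2 \<le> (K - 2 * \<mu>) * z + \<mu>\<^sup>2"
      by (simp add: AE_measure_pmf_iff)
  qed
  also have "\<dots> = (K - 2 * \<mu>) * \<mu> + \<mu>\<^sup>2"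
    by (simp add: Z_integrable mean)
  also have "\<dots> \<le> K * \<mu>" by (simp add: power2_eq_square algebra_simps)
  finally show ?thesis .
qed

text \<open>Proved jointly: the centred first moment cancels the cross term in the induction for the
  second.\<close>

lemma iid_sum_moments:
  "measure_pmf.expectation (iid_sum Z m) (\<lambda>s. s - real m * \<mu>) = 0"
  "measure_pmf.expectation (iid_sum Z m) (\<lambda>s. (s - real m * \<mu>)\<^sup>2) \<le> real m * (K * \<mu>)"
proof -
  have "measure_pmf.expectation (iid_sum Z m) (\<lambda>s. s - real m * \<mu>) = 0 \<and>
    measure_pmf.expectation (iid_sum Z m) (\<lambda>s. (s - real m * \<mu>)\<^sup>2) \<le> real m * (K * \<mu>)"
  proof (induction m)
    case (Suc m)
    note int = integrable_measure_pmf_finite[OF finite_iid_sum]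
    let ?D = "\<lambda>s. s - real m * \<mu>"
    have bind: "measure_pmf.expectation (iid_sum Z (Suc m)) h =
        measure_pmf.expectation Z (\<lambda>z. measure_pmf.expectation (iid_sum Z m) (\<lambda>s. h (z + s)))"
      for h :: "real \<Rightarrow> real"
      using finite_Z finite_iid_sum by (simp add: expectation_bind_finite)
    have e1: "z + s - real (Suc m) * \<mu> = ?D s + (z - \<mu>)" for z s by (simp add: algebra_simps)
    have e2: "(z + s - real (Suc m) * \<mu>)\<^sup>2 = (?D s)\<^sup>2 + (2 * (z - \<mu>)) * ?D s + (z - \<mu>)\<^sup>2" for z s
      by (simp add: power2_eq_square algebra_simps)
    have "measure_pmf.expectation (iid_sum Z (Suc m)) (\<lambda>s. s - real (Suc m) * \<mu>) =
        measure_pmf.expectation Z (\<lambda>z. z - \<mu>)"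
      unfolding bind e1 using Suc.IH
      by (subst Bochner_Integration.integral_add) (auto intro: int)
    also have "\<dots> = 0" by (simp add: Z_integrable mean)
    finally have m1: "measure_pmf.expectation (iid_sum Z (Suc m)) (\<lambda>s. s - real (Suc m) * \<mu>) = 0" .
    have "measure_pmf.expectation (iid_sum Z m) (\<lambda>s. (?D s)\<^sup>2 + (2 * (z - \<mu>)) * ?D s + (z - \<mu>)\<^sup>2) =
        measure_pmf.expectation (iid_sum Z m) (\<lambda>s. (?D s)\<^sup>2) + (z - \<mu>)\<^sup>2" for z
    proof -
      have "measure_pmf.expectation (iid_sum Z m) (\<lambda>s. (?D s)\<^sup>2 + (2 * (z - \<mu>)) * ?D s + (z - \<mu>)\<^sup>2) =
          measure_pmf.expectation (iid_sum Z m) (\<lambda>s. (?D s)\<^sup>2) +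
          measure_pmf.expectation (iid_sum Z m) (\<lambda>s. (2 * (z - \<mu>)) * ?D s) +
          measure_pmf.expectation (iid_sum Z m) (\<lambda>s. (z - \<mu>)\<^sup>2)"
        by (subst Bochner_Integration.integral_add Bochner_Integration.integral_add | intro int refl)+
      also have "measure_pmf.expectation (iid_sum Z m) (\<lambda>s. (2 * (z - \<mu>)) * ?D s) = 0"
        using Suc.IH by (subst integral_mult_right_zero) simp
      finally show ?thesis by simp
    qed
    then have "measure_pmf.expectation (iid_sum Z (Suc m)) (\<lambda>s. (s - real (Suc m) * \<mu>)\<^sup>2) =
        measure_pmf.expectation (iid_sum Z m) (\<lambda>s. (?D s)\<^sup>2) + measure_pmf.expectation Z (\<lambda>z. (z - \<mu>)\<^sup>2)"
      unfolding bind e2 by (simp add: Z_integrable)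
    also have "\<dots> \<le> real m * (K * \<mu>) + K * \<mu>"
      using Suc.IH variance_le by (intro add_mono) auto
    finally show ?case using m1 by (simp add: algebra_simps)
  qed simp
  then show "measure_pmf.expectation (iid_sum Z m) (\<lambda>s. s - real m * \<mu>) = 0"
    "measure_pmf.expectation (iid_sum Z m) (\<lambda>s. (s - real m * \<mu>)\<^sup>2) \<le> real m * (K * \<mu>)" by auto
qed

lemma iid_sum_Chebyshev:
  assumes "0 < d" "\<And>s. s \<in> A \<Longrightarrow> d \<le> \<bar>s - real m * \<mu>\<bar>"
  shows "measure_pmf.prob (iid_sum Z m) A \<le> real m * (K * \<mu>) / d\<^sup>2"
proof -
  note int = integrable_measure_pmf_finite[OF finite_iid_sum]
  have "measure_pmf.prob (iid_sum Z m) A = measure_pmf.expectation (iid_sum Z m) (indicator A)"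
    by simp
  also have "\<dots> \<le> measure_pmf.expectation (iid_sum Z m) (\<lambda>s. (s - real m * \<mu>)\<^sup>2 / d\<^sup>2)"
  proof (intro integral_mono int)
    fix s
    have "d\<^sup>2 \<le> (s - real m * \<mu>)\<^sup>2" if "s \<in> A"
      using assms that by (metis abs_le_square_iff abs_of_pos)
    then show "indicator A s \<le> (s - real m * \<mu>)\<^sup>2 / d\<^sup>2"
      using assms(1) by (auto simp: indicator_def le_divide_eq)
  qed
  also have "\<dots> = measure_pmf.expectation (iid_sum Z m) (\<lambda>s. (s - real m * \<mu>)\<^sup>2) / d\<^sup>2"
    by simp
  also have "\<dots> \<le> real m * (K * \<mu>) / d\<^sup>2"
    using iid_sum_moments(2) by (intro divide_right_mono) auto
  finally show ?thesis .
qed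

text \<open>With \<open>\<delta> = \<epsilon> / 2\<close>, stopping at \<open>J\<close> is good if
  \<open>J * \<mu>\<close> lies between \<open>\<theta> / (1 + \<delta>)\<close> and
  \<open>\<theta> / (1 - \<delta>)\<close>; \<open>j\<close> and \<open>m\<close> are the fixed
  sample counts bracketing this interval. The 100 in \<open>\<theta>\<close> gives
  \<open>\<theta> * \<delta>^2 = 25 * K\<close>, so the two Chebyshev bounds are \<open>3/50\<close>
  and \<open>4/25\<close>, together below \<open>1/4\<close>.\<close>

lemma stopping_rule:
  assumes \<epsilon>: "0 < \<epsilon>" "\<epsilon> < 1" and \<mu>: "0 < \<mu>" and \<theta>: "\<theta> = K / \<epsilon> / \<epsilon> * 100"
  obtains j m :: nat where
    "measure_pmf.prob (iid_sum Z m) {s. s < \<theta>} + measure_pmf.prob (iid_sum Z j) {s. \<theta> \<le> s} \<le> 1 / 4"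
    "\<And>J. j < J \<Longrightarrow> J \<le> m \<Longrightarrow> \<bar>\<theta> / real J - \<mu>\<bar> \<le> \<epsilon> / 2 * \<mu>"
proof -
  define \<delta> where "\<delta> = \<epsilon> / 2"
  have \<delta>: "0 < \<delta>" "\<delta> < 1 / 2" using \<epsilon> by (auto simp: \<delta>_def)
  have K: "0 < K" using \<mu> mean_le by simp
  have \<theta>_\<delta>: "\<theta> * \<delta>\<^sup>2 = 25 * K" using \<epsilon> by (simp add: \<theta> \<delta>_def power2_eq_square)
  have \<theta>0: "0 < \<theta>" using K \<epsilon> by (simp add: \<theta>)
  \<comment> \<open>Ceiling minus one: \<open>j\<close> stays strictly below the lower end, yet
    every \<open>J > j\<close> has reached it.\<close>
  define j where "j = nat \<lceil>\<theta> / ((1 + \<delta>) * \<mu>)\<rceil> - 1"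
  define m where "m = nat \<lfloor>\<theta> / ((1 - \<delta>) * \<mu>)\<rfloor>"
  have j_le: "real j * \<mu> \<le> \<theta> / (1 + \<delta>)"
  proof -
    have "0 < \<theta> / ((1 + \<delta>) * \<mu>)" using \<theta>0 \<delta> \<mu> by simp
    then have "real j \<le> \<theta> / ((1 + \<delta>) * \<mu>)" unfolding j_def by linarith
    then have "real j * ((1 + \<delta>) * \<mu>) \<le> \<theta>" using \<delta> \<mu> by (simp add: pos_le_divide_eq)
    then show ?thesis using \<delta> by (simp add: pos_le_divide_eq ac_simps)
  qed
  have m_bounds: "real m \<le> \<theta> / ((1 - \<delta>) * \<mu>)" "\<theta> / ((1 - \<delta>) * \<mu>) - 1 < real m"
  proof -
    have "0 < \<theta> / ((1 - \<delta>) * \<mu>)" using \<theta>0 \<delta> \<mu> by simp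
    then show "real m \<le> \<theta> / ((1 - \<delta>) * \<mu>)" "\<theta> / ((1 - \<delta>) * \<mu>) - 1 < real m"
      unfolding m_def by linarith+
  qed
  have m_le: "real m * \<mu> \<le> \<theta> / (1 - \<delta>)"
    using m_bounds(1) \<delta> \<mu> by (simp add: field_simps)
  have m_ge: "\<theta> / (1 - \<delta>) - \<mu> \<le> real m * \<mu>"
  proof -
    have "(\<theta> / ((1 - \<delta>) * \<mu>) - 1) * \<mu> \<le> real m * \<mu>"
      using m_bounds(2) \<mu> by (intro mult_right_mono) auto
    moreover have "(\<theta> / ((1 - \<delta>) * \<mu>) - 1) * \<mu> = \<theta> / (1 - \<delta>) - \<mu>"
      using \<mu> \<delta> by (simp add: field_simps)
    ultimately show ?thesis by simp
  qed
  have cancel: "\<theta> / u * K / (\<theta> * \<delta> / u)\<^sup>2 = u * K / (\<theta> * \<delta>\<^sup>2)" if "0 < u" for u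
    using that \<theta>0 \<delta> by (simp add: field_simps power2_eq_square)
  have "measure_pmf.prob (iid_sum Z j) {s. \<theta> \<le> s} \<le> 3 / 50"
  proof -
    define d where "d = \<theta> * \<delta> / (1 + \<delta>)"
    have d0: "0 < d" using \<theta>0 \<delta> by (simp add: d_def)
    have "d = \<theta> - \<theta> / (1 + \<delta>)" using \<delta> by (simp add: d_def field_simps)
    then have "measure_pmf.prob (iid_sum Z j) {s. \<theta> \<le> s} \<le> real j * (K * \<mu>) / d\<^sup>2"
      using j_le by (intro iid_sum_Chebyshev[OF d0]) auto
    also have "\<dots> = (real j * \<mu>) * K / d\<^sup>2" by simp
    also have "\<dots> \<le> (\<theta> / (1 + \<delta>)) * K / d\<^sup>2"
      using j_le K by (intro divide_right_mono mult_right_mono) auto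
    also have "\<dots> = (1 + \<delta>) * K / (\<theta> * \<delta>\<^sup>2)"
      unfolding d_def using \<delta> by (intro cancel) auto
    also have "\<dots> = (1 + \<delta>) / 25" unfolding \<theta>_\<delta> using K by simp
    also have "\<dots> \<le> 3 / 50" using \<delta> by simp
    finally show ?thesis .
  qed
  moreover have "measure_pmf.prob (iid_sum Z m) {s. s < \<theta>} \<le> 4 / 25"
  proof -
    \<comment> \<open>Only half of the available gap: rounding \<open>m\<close> down may lose one
      mean, and \<open>\<mu> \<le> K \<le> d\<close> pays for it from the other half.\<close>
    define d where "d = \<theta> * \<delta> / (2 * (1 - \<delta>))"
    have d0: "0 < d" using \<theta>0 \<delta> by (simp add: d_def)
    have "K \<le> d"
    proof -
      have "2 * K * (1 - \<delta>) * \<delta> \<le> 2 * K * 1 * 1"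
        using K \<delta> by (intro mult_mono) auto
      also have "\<dots> \<le> \<theta> * \<delta>\<^sup>2" using \<theta>_\<delta> K by simp
      finally have "2 * K * (1 - \<delta>) \<le> \<theta> * \<delta>"
        using \<delta> by (simp add: power2_eq_square mult.assoc[symmetric])
      then show ?thesis using \<delta> by (simp add: d_def field_simps)
    qed
    moreover have "\<theta> / (1 - \<delta>) - \<theta> = 2 * d" using \<delta> by (simp add: d_def field_simps)
    ultimately have "d \<le> real m * \<mu> - \<theta>" using m_ge mean_le by linarith
    then have "measure_pmf.prob (iid_sum Z m) {s. s < \<theta>} \<le> real m * (K * \<mu>) / d\<^sup>2"
      by (intro iid_sum_Chebyshev[OF d0]) auto
    also have "\<dots> = (real m * \<mu>) * K / d\<^sup>2" by simp
    also have "\<dots> \<le> (\<theta> / (1 - \<delta>)) * K / d\<^sup>2"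
      using m_le K by (intro divide_right_mono mult_right_mono) auto
    also have "\<dots> = 4 * ((1 - \<delta>) * K / (\<theta> * \<delta>\<^sup>2))"
    proof -
      have "d = \<theta> * \<delta> / (1 - \<delta>) / 2"
        by (simp only: d_def divide_divide_eq_left ac_simps)
      then have d2: "d\<^sup>2 = (\<theta> * \<delta> / (1 - \<delta>))\<^sup>2 / 2\<^sup>2"
        by (simp only: power_divide)
      have "\<theta> / (1 - \<delta>) * K / d\<^sup>2 = 4 * (\<theta> / (1 - \<delta>) * K / (\<theta> * \<delta> / (1 - \<delta>))\<^sup>2)"
        unfolding d2 by simp
      then show ?thesis using cancel[of "1 - \<delta>"] \<delta> by simp
    qed
    also have "\<dots> = 4 * (1 - \<delta>) / 25" unfolding \<theta>_\<delta> using K by simp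
    also have "\<dots> \<le> 4 / 25" using \<delta> by simp
    finally show ?thesis .
  qed
  moreover have "\<bar>\<theta> / real J - \<mu>\<bar> \<le> \<epsilon> / 2 * \<mu>" if J: "j < J" "J \<le> m" for J
  proof -
    have J0: "0 < real J" using J by simp
    have "\<theta> / ((1 + \<delta>) * \<mu>) \<le> real J"
      using J(1) unfolding j_def by linarith
    then have "\<theta> \<le> real J * ((1 + \<delta>) * \<mu>)" using \<delta> \<mu> by (simp add: divide_le_eq)
    then have u: "\<theta> / real J \<le> (1 + \<delta>) * \<mu>" using J0 by (simp add: divide_le_eq mult.commute)
    have "real J \<le> \<theta> / ((1 - \<delta>) * \<mu>)" using J(2) m_bounds(1) by linarith
    then have "real J * ((1 - \<delta>) * \<mu>) \<le> \<theta>" using \<delta> \<mu> by (simp add: le_divide_eq)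
    then have l: "(1 - \<delta>) * \<mu> \<le> \<theta> / real J" using J0 by (simp add: le_divide_eq mult.commute)
    show ?thesis using u l unfolding \<delta>_def[symmetric] distrib_right left_diff_distrib by linarith
  qed
  ultimately show thesis by (intro that[of m j]) auto
qed

end

text \<open>After \<open>J\<close> samples with sum \<open>s < \<theta>\<close>, failure requires
  that the next \<open>m\<close> samples do not reach \<open>\<theta>\<close> (too late) or that the
  next \<open>j - J\<close> do (too early). For \<open>m = 0\<close> the first probability is 1;
  once \<open>J \<ge> j\<close>, truncated subtraction makes the second one 0.\<close>

lemma (in bounded_sample) miss_prob_loop:
  assumes Z: "Z = sample_sum M b t N" and "0 < N"
    and good: "\<And>J. j < J \<Longrightarrow> J \<le> m' \<Longrightarrow> \<theta> * \<Lambda> / (real J * 2) \<in> S"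
    and "loop_inv N \<Lambda> \<theta> J s I R" "s < \<theta>" "J + m = m'"
  shows "miss_prob M b t estimator S (18, I, R) \<le>
    emeasure (measure_pmf (iid_sum Z m)) {z. s + z < \<theta>} +
    emeasure (measure_pmf (iid_sum Z (j - J))) {z. \<theta> \<le> s + z}"
  using assms(4-)
proof (induction m arbitrary: J s I R)
  case 0
  then show ?case
    using miss_prob_le_1[of M b t estimator S] by (simp add: add_increasing2)
next
  case (Suc m)
  let ?F = "miss_prob M b t estimator S"
  \<comment> \<open>Time plays no role here, so any \<open>\<tau>\<close> and the weight 0 will do.\<close>
  interpret cost_functional M b t "\<lambda>_. 0" ?F ?F 0 1
    by unfold_locales (simp_all add: miss_prob_step)
  define L where "L = (\<lambda>m s. emeasure (measure_pmf (iid_sum Z m)) {z. s + z < \<theta>})"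
  define G where "G = (\<lambda>m s. emeasure (measure_pmf (iid_sum Z m)) {z. \<theta> \<le> s + z})"
  have L_Suc: "L (Suc m) s = (\<integral>\<^sup>+ z. L m (s + z) \<partial>measure_pmf Z)" for m s
    by (simp add: L_def emeasure_bind_pmf_eq vimage_def add.assoc)
  have G_Suc: "G (Suc m) s = (\<integral>\<^sup>+ z. G m (s + z) \<partial>measure_pmf Z)" for m s
    by (simp add: G_def emeasure_bind_pmf_eq vimage_def add.assoc)
  \<comment> \<open>Nonnegative samples cannot bring the sum back below the threshold; thus a stop
    before \<open>j\<close> is covered by an event about exactly \<open>j\<close> samples.\<close>
  have G_1: "G m s = 1" if "\<theta> \<le> s" for m s
  proof -
    have "AE z in measure_pmf (iid_sum Z m). \<theta> \<le> s + z"
      using that iid_sum_nonneg by (auto simp: AE_measure_pmf_iff intro: add_increasing2)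
    then show ?thesis unfolding G_def by (intro measure_pmf.emeasure_eq_1_AE) auto
  qed
  have G_0: "G 0 s = 0" if "s < \<theta>" for s using that by (simp add: G_def)
  \<comment> \<open>Stopping after this sample fails only if it is too early; it is not too late,
    since \<open>Suc J \<le> m'\<close>.\<close>
  define g :: ennreal where "g = (if Suc J \<le> j then 1 else 0)"
  have fin: "?F (29, I, R) \<le> g" if "loop_inv N \<Lambda> \<theta> (Suc J) s I R" for I R s
  proof (cases "Suc J \<le> j")
    case True
    then show ?thesis by (simp add: g_def miss_prob_le_1)
  next
    case False
    have "?F (33, I, R) \<le> 0" if "R 0 = \<theta> * \<Lambda> / (real (Suc J) * 2)" for I R
      using that good[of "Suc J"] False Suc.prems(3)
      by (subst miss_prob_success) (auto simp: halted_def length_estimator)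
    with F_finish[OF that, of 0] show ?thesis by (simp add: g_def)
  qed
  have "?F (18, I, R) \<le> 0 * ennreal (real N * (6 + 1) + 4) +
      (\<integral>\<^sup>+ z. (if s + z < \<theta> then L m (s + z) + G (j - Suc J) (s + z) else g) \<partial>measure_pmf Z)"
    unfolding Z
  proof (rule F'_iteration[OF Suc.prems(1) \<open>0 < N\<close>])
    show "?F (18, I, R) \<le> L m s + G (j - Suc J) s"
      if "loop_inv N \<Lambda> \<theta> (Suc J) s I R" "s < \<theta>" for I R s
      unfolding L_def G_def using Suc.prems(3) by (intro Suc.IH[OF that]) simp
  qed (rule fin)
  also have "\<dots> = (\<integral>\<^sup>+ z. (if s + z < \<theta> then L m (s + z) + G (j - Suc J) (s + z) else g) \<partial>measure_pmf Z)"
    by simp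
  also have "\<dots> \<le> L (Suc m) s + G (j - J) s"
  proof (cases "J < j")
    case True
    have "(\<integral>\<^sup>+ z. (if s + z < \<theta> then L m (s + z) + G (j - Suc J) (s + z) else g) \<partial>measure_pmf Z)
        \<le> (\<integral>\<^sup>+ z. L m (s + z) + G (j - Suc J) (s + z) \<partial>measure_pmf Z)"
      using True by (intro nn_integral_mono) (auto simp: G_1 g_def add_increasing)
    also have "\<dots> = L (Suc m) s + G (Suc (j - Suc J)) s"
      by (simp add: nn_integral_add L_Suc G_Suc)
    finally show ?thesis using True by (simp add: Suc_diff_Suc)
  next
    case False
    have "(\<integral>\<^sup>+ z. (if s + z < \<theta> then L m (s + z) + G (j - Suc J) (s + z) else g) \<partial>measure_pmf Z)
        \<le> (\<integral>\<^sup>+ z. L m (s + z) \<partial>measure_pmf Z)"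
      using False by (intro nn_integral_mono) (auto simp: G_0 g_def)
    then show ?thesis by (simp add: L_Suc add_increasing2)
  qed
  finally show ?case by (simp only: L_def G_def)
qed

text \<open>The last sample overshoots \<open>\<theta>\<close> by at most \<open>K\<close>, so
  \<open>(\<theta> + K - s) / \<mu>\<close> bounds the expected number of samples still to come. The
  final 4 pays for the output instructions.\<close>

lemma (in bounded_sample) time_upto_loop:
  assumes Z: "Z = sample_sum M b t N" and "0 < N" and \<mu>: "0 < \<mu>"
    and f: "1 \<le> f" "\<And>v. v < dim_row M \<Longrightarrow> \<tau> v \<le> f"
    and "loop_inv N \<Lambda> \<theta> J s I R" "s < \<theta>"
  shows "time_upto M b t \<tau> estimator k (18, I, R) \<le>
    ennreal ((real N * (6 + f) + 4) * ((\<theta> + K - s) / \<mu>) + 4)"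
  using assms(6-)
proof (induction k arbitrary: J s I R)
  case (Suc k)
  interpret cost_functional M b t \<tau> "time_upto M b t \<tau> estimator k"
      "time_upto M b t \<tau> estimator (Suc k)" 1 f
    by unfold_locales (use f time_upto_le_step[of M b t \<tau> estimator k] in simp_all)
  define c where "c = real N * (6 + f) + 4"
  have c: "0 \<le> c" using f(1) by (simp add: c_def)
  \<comment> \<open>A potential that drops by \<open>c\<close> in expectation per sample; this replaces Wald's identity.\<close>
  define \<Phi> where "\<Phi> = (\<lambda>s. c * ((\<theta> + K - s) / \<mu>) + 4)"
  have "time_upto M b t \<tau> estimator (Suc k) (18, I, R) \<le> 1 * ennreal c +
      (\<integral>\<^sup>+ z. (if s + z < \<theta> then ennreal (\<Phi> (s + z)) else 4) \<partial>measure_pmf Z)"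
    unfolding Z c_def
  proof (rule F'_iteration[OF Suc.prems(1) \<open>0 < N\<close>])
    show "time_upto M b t \<tau> estimator k (18, I, R) \<le> ennreal (\<Phi> s)"
      if "loop_inv N \<Lambda> \<theta> (Suc J) s I R" "s < \<theta>" for I R s
      using Suc.IH[OF that] by (simp add: \<Phi>_def c_def)
    show "time_upto M b t \<tau> estimator k (29, I, R) \<le> 4"
      if "loop_inv N \<Lambda> \<theta> (Suc J) s I R" for I R s
      using F_finish[OF that, of 0] by (simp add: time_upto_halted halted_def length_estimator)
  qed
  also have "(\<integral>\<^sup>+ z. (if s + z < \<theta> then ennreal (\<Phi> (s + z)) else 4) \<partial>measure_pmf Z) \<le>
      (\<integral>\<^sup>+ z. ennreal (\<Phi> (s + z)) \<partial>measure_pmf Z)"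
  proof (intro nn_integral_mono_AE, unfold AE_measure_pmf_iff, intro ballI)
    fix z assume "z \<in> set_pmf Z"
    then have "z \<le> K" using Z_range by auto
    then have "4 \<le> \<Phi> (s + z)" using Suc.prems(2) c \<mu> by (simp add: \<Phi>_def)
    then show "(if s + z < \<theta> then ennreal (\<Phi> (s + z)) else 4) \<le> ennreal (\<Phi> (s + z))"
      using ennreal_leI[of 4 "\<Phi> (s + z)"] by simp
  qed
  also have "\<dots> = ennreal (measure_pmf.expectation Z (\<lambda>z. \<Phi> (s + z)))"
  proof (rule nn_integral_eq_integral[OF Z_integrable], unfold AE_measure_pmf_iff, intro ballI)
    fix z assume "z \<in> set_pmf Z"
    then have "z \<le> K" using Z_range by auto
    then show "0 \<le> \<Phi> (s + z)" using Suc.prems(2) c \<mu> by (simp add: \<Phi>_def)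
  qed
  also have "measure_pmf.expectation Z (\<lambda>z. \<Phi> (s + z)) = measure_pmf.expectation Z (\<lambda>z. \<Phi> s - c / \<mu> * z)"
    using \<mu> by (intro Bochner_Integration.integral_cong) (auto simp: \<Phi>_def field_simps)
  also have "\<dots> = \<Phi> s - c"
    using \<mu> by (simp add: Z_integrable mean)
  also have "1 * ennreal c + ennreal (\<Phi> s - c) = ennreal (\<Phi> s)"
  proof -
    have "\<mu> \<le> \<theta> + K - s" using mean_le Suc.prems(2) by simp
    then have "c * 1 \<le> c * ((\<theta> + K - s) / \<mu>)"
      using c \<mu> by (intro mult_left_mono) auto
    then have "0 \<le> \<Phi> s - c" by (simp add: \<Phi>_def)
    then show ?thesis using c by (simp flip: ennreal_plus)
  qed
  finally show ?case by (simp add: \<Phi>_def c_def)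
qed simp

section \<open>The guarantees of the program\<close>

text \<open>Nonnegative terms give the first inequality. For the second, the geometric tail
  contributes \<open>1 / (1 - q) = 2 / \<gamma>\<close>, and the 1/2 in front of the series cancels
  the 2.\<close>

lemma (in rddz) x_star_truncation:
  assumes b: "b \<in> carrier_vec n" "b \<in> mat_range M" "\<And>i. i < n \<Longrightarrow> 0 \<le> b $ i"
    and t: "t \<in> carrier_vec n" "\<And>i. i < n \<Longrightarrow> 0 \<le> t $ i"
    and n: "0 < n" and \<gamma>: "0 < \<gamma>" "\<gamma> \<le> gamma_max M"
  shows "(\<Sum>l<N. \<Sum>i<n. t $ i * walk_iter M b l $ i) / 2 \<le> scalar_prod t (x_star M b)"
    and "scalar_prod t (x_star M b) \<le> (\<Sum>l<N. \<Sum>i<n. t $ i * walk_iter M b l $ i) / 2 +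
      d_max M * real (norm0 t) * pnorm \<infinity> (diag_powr M (-1) *\<^sub>v t)
       * real (norm0 b) * pnorm \<infinity> (diag_powr M (-1) *\<^sub>v b) / \<gamma> * (1 - \<gamma> / 2) ^ N"
proof -
  define Q where "Q = d_max M * real (norm0 t) * pnorm \<infinity> (diag_powr M (-1) *\<^sub>v t)
       * real (norm0 b) * pnorm \<infinity> (diag_powr M (-1) *\<^sub>v b)"
  define q where "q = 1 - \<gamma> / 2"
  have q: "0 \<le> q" "q < 1" using walk_iter_decay(1)[OF b(1,2) t(1) n \<gamma>] \<gamma>(1) by (auto simp: q_def)
  define s where "s = (\<lambda>l. \<Sum>i<n. t $ i * walk_iter M b l $ i)"
  have nonneg: "0 \<le> walk_iter M b l $ i" if "i < n" for i l
    using walk_iter_nonneg[OF b(1,3) n that] by simp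
  have s0: "0 \<le> s l" for l unfolding s_def using t(2) nonneg by (intro sum_nonneg mult_nonneg_nonneg) auto
  have sQ: "s l \<le> Q * q ^ l" for l
    unfolding s_def Q_def q_def by (rule walk_iter_decay(2)[OF b(1,2) t(1) n \<gamma>])
  have geo: "summable (\<lambda>l. c * q ^ l)" for c using q by (intro summable_mult summable_geometric) auto
  have summ_i: "summable (\<lambda>l. walk_iter M b l $ i)" if i: "i < n" for i
  proof -
    \<comment> \<open>The decay estimate with \<open>t\<close> replaced by a unit vector yields
      summability in each coordinate, needed to exchange the series with the inner product.\<close>
    define c where "c = d_max M * real (norm0 (unit_vec n i :: real Matrix.vec)) *
      pnorm \<infinity> (diag_powr M (-1) *\<^sub>v unit_vec n i) * real (norm0 b) * pnorm \<infinity> (diag_powr M (-1) *\<^sub>v b)"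
    have "walk_iter M b l $ i \<le> c * q ^ l" for l
    proof -
      have "(\<Sum>j<n. unit_vec n i $ j * walk_iter M b l $ j) =
          (\<Sum>j<n. if j = i then walk_iter M b l $ j else 0)"
        using i by (intro sum.cong) (auto simp: unit_vec_def)
      also have "\<dots> = walk_iter M b l $ i" using i by simp
      finally show ?thesis
        using walk_iter_decay(2)[OF b(1,2) _ n \<gamma>, of "unit_vec n i" l] by (simp add: c_def q_def)
    qed
    then show ?thesis
      using nonneg[OF i] by (intro summable_comparison_test'[OF geo[of c], where N = 0]) auto
  qed
  have summ: "summable s" unfolding s_def using summ_i by (intro summable_sum summable_mult) auto
  have "scalar_prod t (x_star M b) = (\<Sum>i<n. t $ i * (1/2 * (\<Sum>l. walk_iter M b l $ i)))"
    by (simp add: scalar_prod_def x_star_def atLeast0LessThan Let_def walk_iter_def lazy_mat_def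
        del: index_mult_mat_vec)
  also have "\<dots> = (\<Sum>i<n. (\<Sum>l. t $ i * walk_iter M b l $ i)) / 2"
    using summ_i by (simp add: sum_divide_distrib suminf_mult)
  also have "\<dots> = suminf s / 2"
    unfolding s_def using summ_i by (subst suminf_sum) (auto intro: summable_mult)
  finally have x: "scalar_prod t (x_star M b) = suminf s / 2" .
  have split: "suminf s = (\<Sum>l. s (l + N)) + sum s {..<N}"
    by (rule suminf_split_initial_segment[OF summ])
  have "0 \<le> (\<Sum>l. s (l + N))"
    using summ s0 by (intro suminf_nonneg) (auto simp: summable_iff_shift)
  then show "(\<Sum>l<N. \<Sum>i<n. t $ i * walk_iter M b l $ i) / 2 \<le> scalar_prod t (x_star M b)"
    unfolding x split by (simp add: s_def)
  have "(\<Sum>l. s (l + N)) \<le> (\<Sum>l. (Q * q ^ N) * q ^ l)"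
    using sQ[of "_ + N"] summ
    by (intro suminf_le geo) (auto simp: summable_iff_shift power_add ac_simps)
  also have "\<dots> = Q * q ^ N * (1 / (1 - q))"
    using q by (simp add: suminf_mult suminf_geometric)
  also have "\<dots> = 2 * (Q / \<gamma> * q ^ N)" using \<gamma> by (simp add: q_def field_simps)
  finally have "scalar_prod t (x_star M b) \<le> sum s {..<N} / 2 + Q / \<gamma> * q ^ N"
    unfolding x split by (simp add: ac_simps)
  then show "scalar_prod t (x_star M b) \<le> (\<Sum>l<N. \<Sum>i<n. t $ i * walk_iter M b l $ i) / 2 +
      d_max M * real (norm0 t) * pnorm \<infinity> (diag_powr M (-1) *\<^sub>v t)
       * real (norm0 b) * pnorm \<infinity> (diag_powr M (-1) *\<^sub>v b) / \<gamma> * (1 - \<gamma> / 2) ^ N"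
    by (simp add: s_def Q_def q_def)
qed

text \<open>At \<open>N - 1\<close> the product still exceeds 1, so
  \<open>(N - 1) * \<gamma> / 2 < ln 4 + ln B\<close>. Here \<open>ln 4 \<le> 2 * ln y\<close>, and
  the summand \<open>\<gamma>\<close> from the \<open>- 1\<close> is at most \<open>4 * ln y\<close>
  because \<open>\<gamma> < 2\<close> and \<open>ln 2 \<ge> 1/2\<close>.\<close>

lemma least_geometric_le:
  fixes B \<gamma> y \<kappa> :: real
  assumes "0 < \<gamma>" "\<gamma> < 2" "2 \<le> y" "y \<le> B" "ln B \<le> \<kappa> * ln y" "0 \<le> \<kappa>"
  obtains N where "0 < N" "\<And>i. i < N \<Longrightarrow> 1 < 4 * B * (1 - \<gamma> / 2) ^ i" "4 * B * (1 - \<gamma> / 2) ^ N \<le> 1"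
    "real N \<le> (8 + 2 * \<kappa>) * (1 / \<gamma> * ln y)"
proof -
  define q where "q = 1 - \<gamma> / 2"
  have q: "0 < q" "q < 1" using assms by (auto simp: q_def)
  have B: "2 \<le> B" using assms by simp
  obtain k where "q ^ k < 1 / (4 * B)" using real_arch_pow_inv[of "1 / (4 * B)" q] q B by auto
  then have "4 * B * q ^ k \<le> 1" using B by (simp add: field_simps)
  then have ex: "\<exists>k. 4 * B * q ^ k \<le> 1" ..
  define N where "N = (LEAST k. 4 * B * q ^ k \<le> 1)"
  have N: "4 * B * q ^ N \<le> 1" unfolding N_def using ex by (rule LeastI_ex)
  have less: "1 < 4 * B * q ^ i" if "i < N" for i
    using not_less_Least[of i "\<lambda>k. 4 * B * q ^ k \<le> 1"] that by (simp add: N_def)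
  have "0 < N" using N B by (cases N) auto
  have ln2: "1 / 2 \<le> ln (2::real)" using ln_le_minus_one[of "1 / 2"] by (simp add: ln_div)
  have lny: "ln 2 \<le> ln y" using assms by simp
  have "0 < ln (4 * B * q ^ (N - 1))" using less[of "N - 1"] \<open>0 < N\<close> by simp
  also have "\<dots> = ln 4 + ln B + real (N - 1) * ln q"
    using B q by (simp add: ln_mult ln_realpow)
  also have "\<dots> \<le> (2 + \<kappa>) * ln y + (real N - 1) * (- \<gamma> / 2)"
  proof -
    have "ln 4 = 2 * ln (2::real)" using ln_realpow[of 2 2] by simp
    then have "ln 4 + ln B \<le> (2 + \<kappa>) * ln y" unfolding distrib_right using lny assms(5) by linarith
    moreover have "ln q \<le> - \<gamma> / 2" using ln_le_minus_one[OF q(1)] by (simp add: q_def)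
    then have "real (N - 1) * ln q \<le> real (N - 1) * (- \<gamma> / 2)"
      by (intro mult_left_mono) auto
    ultimately show ?thesis
      using \<open>0 < N\<close> by (simp add: of_nat_diff)
  qed
  finally have "real N * \<gamma> \<le> \<gamma> + (4 + 2 * \<kappa>) * ln y"
    by (simp add: field_simps)
  also have "\<dots> \<le> 4 * ln y + (4 + 2 * \<kappa>) * ln y"
    using assms lny ln2 by (intro add_right_mono) linarith
  finally have "real N * \<gamma> \<le> (8 + 2 * \<kappa>) * ln y" by (simp add: algebra_simps)
  then have "real N \<le> (8 + 2 * \<kappa>) * (1 / \<gamma> * ln y)" using assms by (simp add: field_simps)
  then show thesis using that[OF \<open>0 < N\<close>] less N by (simp add: q_def)
qed

text \<open>In terms of \<open>Z\<close>, the reciprocals of \<open>\<gamma>\<close> and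
  \<open>E\<close> and the two \<open>norm0\<close> values give \<open>Z ^ 4\<close>,
  \<open>d_max\<close> gives \<open>Z ^ a\<close>, and each maximum norm gives
  \<open>Z ^ (2 * a)\<close>, as it divides by a diagonal entry: exponent
  \<open>5 * a + 4\<close>.\<close>

lemma (in rddz) log_arg_le:
  assumes "admissible a n M b t" "0 < n" "0 < \<gamma>" "0 < E"
  shows "ln (max 2 (log_arg M b t \<gamma> E)) \<le> (5 * real a + 4) * ln (2 + real n + 1 / \<gamma> + 1 / E)"
proof -
  define Z where "Z = 2 + real n + 1 / \<gamma> + 1 / E"
  have pos: "0 < 1 / \<gamma>" "0 < 1 / E" using assms by auto
  have Z: "2 \<le> Z" "1 / \<gamma> \<le> Z" "1 / E \<le> Z" "real n + 1 \<le> Z"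
    using pos by (simp_all add: Z_def)
  have b: "b \<in> carrier_vec n" and t: "t \<in> carrier_vec n"
    and Mr: "\<And>i. i < n \<Longrightarrow> poly_range a n (M $$ (i, i))"
    and br: "\<And>i. i < n \<Longrightarrow> poly_range a n (b $ i)" and tr: "\<And>i. i < n \<Longrightarrow> poly_range a n (t $ i)"
    using assms(1) by (auto simp: admissible_def)
  have ZA: "(real n + 1) ^ a \<le> Z ^ a" using Z by (intro power_mono) auto
  have le: "\<bar>y\<bar> \<le> Z ^ a" if "poly_range a n y" for y
    using that ZA Z by (auto simp: poly_range_def)
  have dm: "d_max M \<le> Z ^ a"
    unfolding d_max_def using assms(2) le[OF Mr] diag_pos
    by (subst Max_le_iff) (auto simp: abs_le_iff)
  have dm0: "0 \<le> d_max M"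
    using diag_pos[OF assms(2)] assms(2) unfolding d_max_def
    by (intro order_trans[OF _ Max_ge[of _ "M $$ (0, 0)"]]) auto
  have inf: "pnorm \<infinity> (diag_powr M (-1) *\<^sub>v v) \<le> Z ^ a * Z ^ a"
    if v: "v \<in> carrier_vec n" "\<And>i. i < n \<Longrightarrow> poly_range a n (v $ i)" for v
  proof -
    have "\<bar>(diag_powr M (-1) *\<^sub>v v) $ i\<bar> \<le> Z ^ a * Z ^ a" if i: "i < n" for i
    proof -
      have "1 / (real n + 1) ^ a \<le> M $$ (i, i)" using Mr[OF i] diag_pos[OF i] by (auto simp: poly_range_def)
      then have "inverse (M $$ (i, i)) \<le> inverse (1 / (real n + 1) ^ a)" by (intro le_imp_inverse_le) auto
      also have "\<dots> \<le> Z ^ a" using ZA by simp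
      finally have "\<bar>v $ i\<bar> * inverse (M $$ (i, i)) \<le> Z ^ a * Z ^ a"
        using le[OF v(2)[OF i]] diag_pos[OF i] Z by (intro mult_mono) auto
      then show ?thesis
        using diag_pos[OF i] v(1) i
        by (simp add: diag_inv_mult_vec abs_div divide_inverse abs_mult del: index_mult_mat_vec)
    qed
    then show ?thesis
      using assms(2) carrier_matD[OF diag_powr_carrier]
      unfolding pnorm_def by (simp, subst Max_le_iff) auto
  qed
  have n0: "real (norm0 v) \<le> Z" if "v \<in> carrier_vec n" for v
    using norm0_le_dim[of v] that Z by simp
  have inf0: "0 \<le> pnorm \<infinity> (diag_powr M (-1) *\<^sub>v v)" for v
    using assms(2) carrier_matD[OF diag_powr_carrier] by (intro pnorm_nonneg) simp
  have "log_arg M b t \<gamma> E = 1 / \<gamma> * (1 / E) * d_max M * real (norm0 t) * pnorm \<infinity> (diag_powr M (-1) *\<^sub>v t)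
       * real (norm0 b) * pnorm \<infinity> (diag_powr M (-1) *\<^sub>v b)"
    by (simp add: log_arg_def)
  also have "\<dots> \<le> Z * Z * Z ^ a * Z * (Z ^ a * Z ^ a) * Z * (Z ^ a * Z ^ a)"
    using pos Z dm dm0 n0[OF t] n0[OF b] inf[OF t tr] inf[OF b br] inf0
    by (intro mult_mono mult_nonneg_nonneg) auto
  also have "\<dots> = Z ^ (5 * a + 4)"
  proof -
    have "5 * a + 4 = a + a + a + a + a + 4" by simp
    then show ?thesis by (simp only: power_add) (simp add: power4_eq_xxxx ac_simps)
  qed
  finally have "log_arg M b t \<gamma> E \<le> Z ^ (5 * a + 4)" .
  moreover have "2 \<le> Z ^ (5 * a + 4)"
    using Z(1) power_increasing[of 1 "5 * a + 4" Z] by simp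
  ultimately have "ln (max 2 (log_arg M b t \<gamma> E)) \<le> ln (Z ^ (5 * a + 4))"
    by (intro ln_mono) auto
  also have "\<dots> = (5 * real a + 4) * ln Z" using Z(1) by (simp add: ln_realpow)
  finally show ?thesis by (simp add: Z_def)
qed

section \<open>One problem instance: accuracy and cost of the program\<close>

locale estimation_problem = rddz n M for n :: nat and M :: "real mat" +
  fixes b t :: "real Matrix.vec" and \<tau> :: "nat \<Rightarrow> real" and a :: nat and \<kappa> \<epsilon> \<gamma> B :: real
  assumes adm: "admissible a n M b t"
    and b_nonneg: "\<And>i. i < n \<Longrightarrow> 0 \<le> b $ i" and t_nonneg: "\<And>i. i < n \<Longrightarrow> 0 \<le> t $ i"
    and x_pos: "0 < scalar_prod t (x_star M b)"
    and \<epsilon>: "0 < \<epsilon>" and \<gamma>: "0 < \<gamma>" "\<gamma> \<le> gamma_max M" and \<kappa>: "1 \<le> \<kappa>"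
    and \<tau>: "\<And>v. v < n \<Longrightarrow> 1 \<le> \<tau> v"
    and B: "max 2 (log_arg M b t \<gamma> (\<epsilon> * scalar_prod t (x_star M b))) \<le> B"
      "ln B \<le> \<kappa> * ln (max 2 (log_arg M b t \<gamma> (\<epsilon> * scalar_prod t (x_star M b))))"
begin

definition "x = scalar_prod t (x_star M b)"
definition "\<Lambda> = pnorm 1 t"
definition "\<beta> = pnorm \<infinity> (diag_powr M (-1) *\<^sub>v b)"
definition "f = f_row n \<tau>"
definition "\<L> = L_param M b t \<gamma> (\<epsilon> * x)"

lemma b: "b \<in> carrier_vec n" "b \<in> mat_range M" and b_nz: "b \<noteq> 0\<^sub>v n"
  and t: "t \<in> carrier_vec n" "t \<noteq> 0\<^sub>v n"
  using adm by (auto simp: admissible_def)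

lemma n_pos: "0 < n"
  using b(1) b_nz by (cases "n = 0") auto

lemma x0: "0 < x" using x_pos by (simp add: x_def)

lemma \<Lambda>0: "0 < \<Lambda>"
  unfolding \<Lambda>_def by (rule pnorm_1_pos[OF b(1) b_nonneg n_pos t(1) t_nonneg t(2)])

lemma f_ge: "1 \<le> f" "v < n \<Longrightarrow> \<tau> v \<le> f"
proof -
  show le: "\<tau> v \<le> f" if "v < n" for v using that by (auto simp: f_def f_row_def)
  show "1 \<le> f" using le[OF n_pos] \<tau>[OF n_pos] by simp
qed

lemma gamma_less_2: "\<gamma> < 2"
  by (rule walk_iter_decay(1)[OF b t(1) n_pos \<gamma>])

text \<open>The first three conditions single out the value computed by the counting loop; the last
  one records that it is \<open>O(L)\<close>.\<close>

definition "truncation N \<longleftrightarrow> 0 < N \<and> (\<forall>i<N. 1 < 4 * B * (1 - \<gamma> / 2) ^ i) \<and>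
  4 * B * (1 - \<gamma> / 2) ^ N \<le> 1 \<and> real N \<le> (8 + 2 * \<kappa>) * \<L>"

lemma truncation_exists: "\<exists>N. truncation N"
proof -
  obtain N where "0 < N" "\<And>i. i < N \<Longrightarrow> 1 < 4 * B * (1 - \<gamma> / 2) ^ i"
    "4 * B * (1 - \<gamma> / 2) ^ N \<le> 1" "real N \<le> (8 + 2 * \<kappa>) * \<L>"
    unfolding \<L>_def L_param_def x_def
    by (rule least_geometric_le[OF \<gamma>(1) gamma_less_2 _ B]) (use \<kappa> in auto)
  then show ?thesis unfolding truncation_def by blast
qed

definition "mean N = measure_pmf.expectation (sample_sum M b t N) (\<lambda>z. z)"

lemma bounded_sample: "bounded_sample (sample_sum M b t N) (real N * \<beta>) (mean N)"
  using sample_sum_support[OF b(1) b_nonneg n_pos t(1) t_nonneg t(2), of N]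
  by unfold_locales (auto simp: \<beta>_def mean_def)

text \<open>\<open>log_arg\<close> is the tail constant divided by \<open>\<epsilon> * x\<close>.
  Hence \<open>B\<close>, which bounds it, makes the truncation error relative to the unknown
  \<open>x\<close>: it is at most \<open>\<epsilon> / 4 * x\<close> times
  \<open>4 * B * (1 - \<gamma> / 2) ^ N\<close>.\<close>

lemma mean_bounds:
  assumes N: "truncation N"
  shows "\<Lambda> * mean N / 2 \<le> x" "x \<le> \<Lambda> * mean N / 2 + \<epsilon> / 4 * x"
proof -
  note x = x_star_truncation[OF b b_nonneg t(1) t_nonneg n_pos \<gamma>, of N]
  have m: "(\<Sum>l<N. \<Sum>i<n. t $ i * walk_iter M b l $ i) = \<Lambda> * mean N"
    unfolding \<Lambda>_def mean_def
    by (rule expectation_sample_sum[OF b(1) b_nonneg n_pos t(1) t_nonneg t(2), symmetric])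
  show "\<Lambda> * mean N / 2 \<le> x" using x(1) by (simp add: m x_def)
  define Q where "Q = d_max M * real (norm0 t) * pnorm \<infinity> (diag_powr M (-1) *\<^sub>v t)
       * real (norm0 b) * pnorm \<infinity> (diag_powr M (-1) *\<^sub>v b)"
  have "log_arg M b t \<gamma> (\<epsilon> * x) = Q / \<gamma> / (\<epsilon> * x)"
    by (simp add: log_arg_def Q_def)
  then have "Q / \<gamma> / (\<epsilon> * x) \<le> B" using B(1) by (simp add: x_def)
  then have "Q / \<gamma> \<le> B * (\<epsilon> * x)"
    by (subst (asm) pos_divide_le_eq) (use \<epsilon> x0 in auto)
  then have "Q / \<gamma> * (1 - \<gamma> / 2) ^ N \<le> B * (\<epsilon> * x) * (1 - \<gamma> / 2) ^ N"
    using gamma_less_2 by (intro mult_right_mono) auto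
  also have "\<dots> = \<epsilon> / 4 * x * (4 * B * (1 - \<gamma> / 2) ^ N)" by simp
  also have "\<dots> \<le> \<epsilon> / 4 * x * 1"
    using N \<epsilon> x0 by (intro mult_left_mono) (auto simp: truncation_def)
  finally show "x \<le> \<Lambda> * mean N / 2 + \<epsilon> / 4 * x"
    using x(2) unfolding m x_def[symmetric] Q_def[symmetric] by linarith
qed

text \<open>\<open>G\<close> is the claimed cost with \<open>N\<close> in place of \<open>L\<close>.
  That it dominates both 1 and \<open>N\<close> lets it absorb the set-up and the counting loop. For
  \<open>\<epsilon> \<le> 1\<close> truncation loses at most a quarter of \<open>x\<close>, which
  yields \<open>x \<le> \<Lambda> * mean N\<close>.\<close>

lemma scale_bounds:
  assumes N: "truncation N" and "\<epsilon> \<le> 1"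
  defines "G \<equiv> (real N)\<^sup>2 * (f * \<Lambda> * \<beta>) / (\<epsilon>\<^sup>2 * x)"
  shows "0 < mean N" "real N \<le> G" "1 \<le> G" "1 / mean N \<le> \<Lambda> / x"
    "G \<le> (8 + 2 * \<kappa>)\<^sup>2 * (f * \<Lambda> * \<beta> * \<L>\<^sup>2 / (\<epsilon>\<^sup>2 * x))"
proof -
  interpret bounded_sample "sample_sum M b t N" "real N * \<beta>" "mean N"
    by (rule bounded_sample)
  have N1: "1 \<le> real N" using N by (simp add: truncation_def Suc_le_eq)
  have "\<epsilon> / 4 * x \<le> 1 / 4 * x" using assms(2) x0 by (intro mult_right_mono) auto
  then have x_le: "x \<le> \<Lambda> * mean N" using mean_bounds(2)[OF N] x0 by linarith
  then have "0 < \<Lambda> * mean N" using x0 by linarith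
  then show m0: "0 < mean N" using \<Lambda>0 by (simp add: zero_less_mult_iff)
  show "1 / mean N \<le> \<Lambda> / x" using x_le x0 m0 by (simp add: divide_simps)
  have \<beta>0: "0 < \<beta>" using m0 mean_le N1 by (smt (verit) mult_nonneg_nonpos)
  have U: "0 \<le> f * \<Lambda> * \<beta>" using f_ge(1) \<Lambda>0 \<beta>0 by simp
  have "\<epsilon>\<^sup>2 * x \<le> 1 * x" using assms(2) \<epsilon> x0 by (intro mult_right_mono) (auto simp: power_le_one)
  also have "\<dots> \<le> \<Lambda> * (real N * \<beta>)"
    using x_le mean_le \<Lambda>0 by (smt (verit) mult_left_mono)
  also have "\<dots> \<le> f * (\<Lambda> * (real N * \<beta>))"
    using mult_right_mono[OF f_ge(1), of "\<Lambda> * (real N * \<beta>)"] \<Lambda>0 \<beta>0 by simp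
  finally have *: "\<epsilon>\<^sup>2 * x \<le> real N * (f * \<Lambda> * \<beta>)" by (simp add: ac_simps)
  have den: "0 < \<epsilon>\<^sup>2 * x" using \<epsilon> x0 by simp
  have "real N * (\<epsilon>\<^sup>2 * x) \<le> real N * (real N * (f * \<Lambda> * \<beta>))"
    using * N1 by (intro mult_left_mono) auto
  then show NG: "real N \<le> G"
    unfolding G_def pos_le_divide_eq[OF den] by (simp add: power2_eq_square mult.assoc)
  then show "1 \<le> G" using N1 by simp
  have "(real N)\<^sup>2 \<le> ((8 + 2 * \<kappa>) * \<L>)\<^sup>2"
    using N by (intro power_mono) (auto simp: truncation_def)
  then have "(real N)\<^sup>2 * (f * \<Lambda> * \<beta>) / (\<epsilon>\<^sup>2 * x) \<le> ((8 + 2 * \<kappa>) * \<L>)\<^sup>2 * (f * \<Lambda> * \<beta>) / (\<epsilon>\<^sup>2 * x)"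
    using U den by (intro divide_right_mono mult_right_mono) auto
  then show "G \<le> (8 + 2 * \<kappa>)\<^sup>2 * (f * \<Lambda> * \<beta> * \<L>\<^sup>2 / (\<epsilon>\<^sup>2 * x))"
    unfolding G_def by (simp add: power_mult_distrib ac_simps)
qed

lemma estimator_success: "output_prob M b t estimator (init_config M b t \<epsilon> \<gamma> B) {y. \<bar>y - x\<bar> \<le> \<epsilon> * x} \<ge> 3/4"
proof -
  let ?S = "{y. \<bar>y - x\<bar> \<le> \<epsilon> * x}"
  let ?F = "miss_prob M b t estimator ?S"
  interpret F: cost_functional M b t "\<lambda>_. 0" ?F ?F 0 1
    by unfold_locales (simp_all add: miss_prob_step)
  have "?F (init_config M b t \<epsilon> \<gamma> B) \<le> ennreal (1 / 4)"
  proof (cases "\<epsilon> < 1")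
    case False
    have "?F (33, I, R) \<le> 0" if "R 0 = 0" for I R
    proof -
      have "x \<le> \<epsilon> * x" using False x0 by simp
      then show ?thesis
        using that x0 by (subst miss_prob_success) (auto simp: halted_def length_estimator)
    qed
    with F.F_init_coarse[of \<epsilon> 0 \<gamma> B] False show ?thesis by simp
  next
    case True
    obtain N where N: "truncation N" using truncation_exists ..
    interpret bounded_sample "sample_sum M b t N" "real N * \<beta>" "mean N"
      by (rule bounded_sample)
    define \<theta> where "\<theta> = real N * \<beta> / \<epsilon> / \<epsilon> * 100"
    have N0: "0 < N" using N by (simp add: truncation_def)
    have m0: "0 < mean N" using scale_bounds(1)[OF N] True by simp
    have \<theta>0: "0 < \<theta>" using m0 mean_le \<epsilon> by (simp add: \<theta>_def)
    obtain j m where jm: "measure_pmf.prob (iid_sum (sample_sum M b t N) m) {s. s < \<theta>} +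
        measure_pmf.prob (iid_sum (sample_sum M b t N) j) {s. \<theta> \<le> s} \<le> 1 / 4"
      and close: "\<And>J. j < J \<Longrightarrow> J \<le> m \<Longrightarrow> \<bar>\<theta> / real J - mean N\<bar> \<le> \<epsilon> / 2 * mean N"
      using stopping_rule[OF \<epsilon> True m0 \<theta>_def] by metis
    have good: "\<theta> * \<Lambda> / (real J * 2) \<in> ?S" if "j < J" "J \<le> m" for J
    proof -
      \<comment> \<open>The value of the truncated series: sampling errs from it by at most
        \<open>\<epsilon> / 2 * x\<close>, and it differs from \<open>x\<close> by at most
        \<open>\<epsilon> / 4 * x\<close>.\<close>
      define xN where "xN = \<Lambda> * mean N / 2"
      have e: "\<theta> * \<Lambda> / (real J * 2) - xN = \<Lambda> / 2 * (\<theta> / real J - mean N)"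
        by (simp add: xN_def right_diff_distrib mult.commute)
      have "\<bar>\<theta> * \<Lambda> / (real J * 2) - xN\<bar> = \<Lambda> / 2 * \<bar>\<theta> / real J - mean N\<bar>"
        unfolding e abs_mult using \<Lambda>0 by simp
      also have "\<dots> \<le> \<Lambda> / 2 * (\<epsilon> / 2 * mean N)"
        using close[OF that] \<Lambda>0 by (intro mult_left_mono) auto
      also have "\<dots> = \<epsilon> / 2 * xN" by (simp add: xN_def)
      also have "\<dots> \<le> \<epsilon> / 2 * x"
        using mean_bounds(1)[OF N] \<epsilon> by (intro mult_left_mono) (auto simp: xN_def)
      finally have "\<bar>\<theta> * \<Lambda> / (real J * 2) - xN\<bar> \<le> \<epsilon> / 2 * x" .
      moreover have "\<bar>xN - x\<bar> \<le> \<epsilon> / 4 * x"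
        using mean_bounds[OF N] by (simp add: xN_def)
      moreover have "\<epsilon> / 2 * x + \<epsilon> / 4 * x \<le> \<epsilon> * x" using \<epsilon> x0 by simp
      ultimately show ?thesis unfolding mem_Collect_eq by linarith
    qed
    have "?F (init_config M b t \<epsilon> \<gamma> B) \<le> 0 * ennreal (14 + real N * 3) +
        (emeasure (measure_pmf (iid_sum (sample_sum M b t N) m)) {z. 0 + z < \<theta>} +
         emeasure (measure_pmf (iid_sum (sample_sum M b t N) (j - 0))) {z. \<theta> \<le> 0 + z})"
    proof (rule F.F_init)
      show "?F (18, I, R) \<le> emeasure (measure_pmf (iid_sum (sample_sum M b t N) m)) {z. 0 + z < \<theta>} +
         emeasure (measure_pmf (iid_sum (sample_sum M b t N) (j - 0))) {z. \<theta> \<le> 0 + z}"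
        if "loop_inv N (pnorm 1 t) (real N * pnorm \<infinity> (diag_powr M (-1) *\<^sub>v b) / \<epsilon> / \<epsilon> * 100) 0 0 I R" for I R
      proof (rule miss_prob_loop[OF refl N0 good])
        show "loop_inv N \<Lambda> \<theta> 0 0 I R" using that by (simp add: \<Lambda>_def \<theta>_def \<beta>_def)
      qed (use \<theta>0 in auto)
    qed (use N True in \<open>auto simp: truncation_def\<close>)
    also have "\<dots> = ennreal (measure_pmf.prob (iid_sum (sample_sum M b t N) m) {s. s < \<theta>} +
        measure_pmf.prob (iid_sum (sample_sum M b t N) j) {s. \<theta> \<le> s})"
      by (simp add: measure_pmf.emeasure_eq_measure)
    also have "\<dots> \<le> ennreal (1 / 4)" using jm by (rule ennreal_leI)
    finally show ?thesis .
  qed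
  from output_prob_geI[OF this] show ?thesis by simp
qed

lemma estimator_time_coarse:
  assumes "1 \<le> \<epsilon>"
  shows "expected_time M b t \<tau> estimator (init_config M b t \<epsilon> \<gamma> B) \<le> 3"
proof (rule expected_time_leI)
  fix k
  interpret cost_functional M b t \<tau> "time_upto M b t \<tau> estimator k" "time_upto M b t \<tau> estimator k" 1 f
    by unfold_locales (use f_ge time_upto_le_step[of M b t \<tau> estimator k] in simp_all)
  show "time_upto M b t \<tau> estimator k (init_config M b t \<epsilon> \<gamma> B) \<le> 3"
    using F_init_coarse[OF assms, of 0 \<gamma> B] by (simp add: time_upto_halted halted_def length_estimator)
qed

text \<open>\<open>1132 = 11 * 101 + 4 + 14 + 3\<close>: a sample costs at most
  \<open>11 * (N * f)\<close>, the threshold plus overshoot is at most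
  \<open>101 * K / \<epsilon>^2\<close>, and the rest is output, set-up and counting loop, absorbed
  by \<open>G\<close>.\<close>

lemma estimator_time_fine:
  assumes "\<epsilon> < 1" "truncation N"
  shows "expected_time M b t \<tau> estimator (init_config M b t \<epsilon> \<gamma> B) \<le>
    ennreal (1132 * ((real N)\<^sup>2 * (f * \<Lambda> * \<beta>) / (\<epsilon>\<^sup>2 * x)))"
proof (rule expected_time_leI)
  fix k
  interpret cost_functional M b t \<tau> "time_upto M b t \<tau> estimator k" "time_upto M b t \<tau> estimator k" 1 f
    by unfold_locales (use f_ge time_upto_le_step[of M b t \<tau> estimator k] in simp_all)
  interpret bounded_sample "sample_sum M b t N" "real N * \<beta>" "mean N"
    by (rule bounded_sample)
  define \<theta> where "\<theta> = real N * \<beta> / \<epsilon> / \<epsilon> * 100"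
  define G where "G = (real N)\<^sup>2 * (f * \<Lambda> * \<beta>) / (\<epsilon>\<^sup>2 * x)"
  note sb = scale_bounds[OF assms(2) less_imp_le[OF assms(1)], folded G_def]
  have N0: "0 < N" using assms(2) by (simp add: truncation_def)
  then have N1: "1 \<le> real N" by simp
  have K0: "0 < real N * \<beta>" using sb(1) mean_le by simp
  have \<theta>0: "0 < \<theta>" using K0 \<epsilon> by (simp add: \<theta>_def)
  define X where "X = (real N * (6 + f) + 4) * ((\<theta> + real N * \<beta> - 0) / mean N) + 4"
  have X0: "0 \<le> X" using \<theta>0 K0 sb(1) f_ge(1) by (simp add: X_def)
  have "time_upto M b t \<tau> estimator k (init_config M b t \<epsilon> \<gamma> B) \<le> 1 * ennreal (14 + real N * 3) + ennreal X"
  proof (rule F_init)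
    show "time_upto M b t \<tau> estimator k (18, I, R) \<le> ennreal X"
      if "loop_inv N (pnorm 1 t) (real N * pnorm \<infinity> (diag_powr M (-1) *\<^sub>v b) / \<epsilon> / \<epsilon> * 100) 0 0 I R" for I R
      unfolding X_def
    proof (rule time_upto_loop[OF refl N0 sb(1)])
      show "loop_inv N \<Lambda> \<theta> 0 0 I R" using that by (simp add: \<Lambda>_def \<theta>_def \<beta>_def)
    qed (use \<theta>0 f_ge in auto)
  qed (use assms in \<open>auto simp: truncation_def\<close>)
  also have "\<dots> = ennreal (14 + real N * 3 + X)"
    using X0 by simp
  also have "\<dots> \<le> ennreal (1132 * G)"
  proof (rule ennreal_leI)
    have "\<theta> + real N * \<beta> - 0 \<le> 101 * (real N * \<beta>) / \<epsilon>\<^sup>2"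
    proof -
      have "real N * \<beta> * \<epsilon>\<^sup>2 \<le> real N * \<beta> * 1"
        using K0 \<epsilon> assms(1) by (intro mult_left_mono) (auto simp: power_le_one)
      then show ?thesis using \<epsilon> by (simp add: \<theta>_def field_simps power2_eq_square)
    qed
    then have h1: "(\<theta> + real N * \<beta> - 0) * (1 / mean N) \<le> 101 * (real N * \<beta>) / \<epsilon>\<^sup>2 * (\<Lambda> / x)"
      using sb(1,4) K0 \<epsilon> by (intro mult_mono) auto
    have h2: "real N * (6 + f) + 4 \<le> 11 * (real N * f)"
    proof -
      have "real N * 1 \<le> real N * f" using f_ge(1) by (intro mult_left_mono) auto
      then show ?thesis unfolding distrib_left using N1 by linarith
    qed
    have "(real N * (6 + f) + 4) * ((\<theta> + real N * \<beta> - 0) * (1 / mean N)) \<le>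
        11 * (real N * f) * (101 * (real N * \<beta>) / \<epsilon>\<^sup>2 * (\<Lambda> / x))"
      using f_ge(1) \<theta>0 K0 sb(1) by (intro mult_mono[OF h2 h1]) auto
    also have "\<dots> = 1111 * G"
      by (simp add: G_def power2_eq_square)
    finally have "X \<le> 1111 * G + 4" by (simp add: X_def)
    then show "14 + real N * 3 + X \<le> 1132 * G" using sb(2,3) by simp
  qed
  finally show "time_upto M b t \<tau> estimator k (init_config M b t \<epsilon> \<gamma> B) \<le>
    ennreal (1132 * ((real N)\<^sup>2 * (f * \<Lambda> * \<beta>) / (\<epsilon>\<^sup>2 * x)))"
    by (simp add: G_def)
qed

lemma estimator_time:
  assumes "\<epsilon> \<le> 1"
  shows "expected_time M b t \<tau> estimator (init_config M b t \<epsilon> \<gamma> B) \<le>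
    ennreal (1132 * (8 + 2 * \<kappa>)\<^sup>2 * (f * \<Lambda> * \<beta> * \<L>\<^sup>2 / (\<epsilon>\<^sup>2 * x)))"
proof -
  obtain N where N: "truncation N" using truncation_exists ..
  define G where "G = (real N)\<^sup>2 * (f * \<Lambda> * \<beta>) / (\<epsilon>\<^sup>2 * x)"
  note sb = scale_bounds[OF N assms, folded G_def]
  have "expected_time M b t \<tau> estimator (init_config M b t \<epsilon> \<gamma> B) \<le> ennreal (1132 * G)"
  proof (cases "\<epsilon> < 1")
    case True
    then show ?thesis using estimator_time_fine[OF _ N] by (simp add: G_def)
  next
    case False
    then have "expected_time M b t \<tau> estimator (init_config M b t \<epsilon> \<gamma> B) \<le> ennreal 3"
      using estimator_time_coarse by simp
    also have "\<dots> \<le> ennreal (1132 * G)" using sb(3) by (intro ennreal_leI) simp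
    finally show ?thesis .
  qed
  also have "\<dots> \<le> ennreal (1132 * (8 + 2 * \<kappa>)\<^sup>2 * (f * \<Lambda> * \<beta> * \<L>\<^sup>2 / (\<epsilon>\<^sup>2 * x)))"
    using sb(5) by (intro ennreal_leI) simp
  finally show ?thesis .
qed

lemma time_bound_polylog:
  "f * \<Lambda> * \<beta> * \<L>\<^sup>2 / (\<epsilon>\<^sup>2 * x) \<le>
    (5 * real a + 4)\<^sup>2 * (f * \<Lambda> * \<beta> / (\<gamma>\<^sup>2 * \<epsilon>\<^sup>2 * x)) * ln (2 + real n + 1 / \<gamma> + 1 / (\<epsilon> * x)) ^ 2"
proof -
  have \<beta>0: "0 \<le> \<beta>"
    unfolding \<beta>_def using n_pos carrier_matD[OF diag_powr_carrier] by (intro pnorm_nonneg) simp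
  define y where "y = ln (max 2 (log_arg M b t \<gamma> (\<epsilon> * x)))"
  define z where "z = (5 * real a + 4) * ln (2 + real n + 1 / \<gamma> + 1 / (\<epsilon> * x))"
  have "y \<le> z" unfolding y_def z_def using \<epsilon> x0 by (intro log_arg_le[OF adm n_pos \<gamma>(1)]) simp
  moreover have "0 \<le> y" by (simp add: y_def)
  ultimately have "y\<^sup>2 \<le> z\<^sup>2" by (intro power_mono)
  then have "f * \<Lambda> * \<beta> / (\<gamma>\<^sup>2 * \<epsilon>\<^sup>2 * x) * y\<^sup>2 \<le> f * \<Lambda> * \<beta> / (\<gamma>\<^sup>2 * \<epsilon>\<^sup>2 * x) * z\<^sup>2"
    using f_ge(1) \<Lambda>0 \<beta>0 x0 by (intro mult_left_mono) auto
  moreover have "f * \<Lambda> * \<beta> * \<L>\<^sup>2 / (\<epsilon>\<^sup>2 * x) = f * \<Lambda> * \<beta> / (\<gamma>\<^sup>2 * \<epsilon>\<^sup>2 * x) * y\<^sup>2"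
    by (simp add: \<L>_def L_param_def y_def power_mult_distrib power_divide)
  ultimately show ?thesis by (simp add: z_def power_mult_distrib ac_simps)
qed

text \<open>For \<open>\<epsilon> > 1\<close> the scale \<open>T\<close> may fall below the cost of
  three instructions, hence the variant with \<open>max 1 T\<close>. \<open>C\<close> adds the
  constants of the time bound and of the logarithm bound so that one constant serves both.\<close>

lemma estimator_guarantees:
  defines "E \<equiv> \<epsilon> * scalar_prod t (x_star M b)"
    and "U \<equiv> f_row n \<tau> * pnorm 1 t * pnorm \<infinity> (diag_powr M (-1) *\<^sub>v b)"
  defines "T \<equiv> U * (L_param M b t \<gamma> E)\<^sup>2 / (\<epsilon>\<^sup>2 * scalar_prod t (x_star M b))"
    and "c \<equiv> init_config M b t \<epsilon> \<gamma> B"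
  assumes C: "C = 1132 * (8 + 2 * \<kappa>)\<^sup>2 + (5 * real a + 4)\<^sup>2"
  shows "output_prob M b t estimator c
      {y. \<bar>y - scalar_prod t (x_star M b)\<bar> \<le> \<epsilon> * scalar_prod t (x_star M b)} \<ge> 3/4 \<and>
    (\<epsilon> \<le> 1 \<longrightarrow> expected_time M b t \<tau> estimator c \<le> ennreal (C * T)) \<and>
    expected_time M b t \<tau> estimator c \<le> ennreal (C * max 1 T) \<and>
    T \<le> C * (U / (\<gamma>\<^sup>2 * \<epsilon>\<^sup>2 * scalar_prod t (x_star M b))) * ln (2 + real n + 1 / \<gamma> + 1 / E) ^ 2"
proof -
  have T: "T = f * \<Lambda> * \<beta> * \<L>\<^sup>2 / (\<epsilon>\<^sup>2 * x)" and U: "U = f * \<Lambda> * \<beta>" and E: "E = \<epsilon> * x"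
    by (simp_all add: T_def U_def E_def x_def \<Lambda>_def \<beta>_def f_def \<L>_def)
  have "0 \<le> \<beta>"
    unfolding \<beta>_def using n_pos carrier_matD[OF diag_powr_carrier] by (intro pnorm_nonneg) simp
  then have U0: "0 \<le> U" using f_ge(1) \<Lambda>0 by (simp add: U)
  then have T0: "0 \<le> T" using x0 by (simp add: T flip: U)
  have "1\<^sup>2 \<le> (8 + 2 * \<kappa>)\<^sup>2" using \<kappa> by (intro power_mono) auto
  then have "1132 \<le> 1132 * (8 + 2 * \<kappa>)\<^sup>2" by simp
  then have C3: "3 \<le> C" unfolding C using zero_le_power2[of "5 * real a + 4"] by linarith
  have small: "expected_time M b t \<tau> estimator c \<le> ennreal (C * T)" if "\<epsilon> \<le> 1"
  proof -
    have "expected_time M b t \<tau> estimator c \<le> ennreal (1132 * (8 + 2 * \<kappa>)\<^sup>2 * T)"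
      using estimator_time[OF that] by (simp only: T c_def)
    also have "\<dots> \<le> ennreal (C * T)"
      using T0 by (intro ennreal_leI mult_right_mono) (auto simp: C)
    finally show ?thesis .
  qed
  moreover have "expected_time M b t \<tau> estimator c \<le> ennreal (C * max 1 T)"
  proof (cases "\<epsilon> \<le> 1")
    case True
    have "C * T \<le> C * max 1 T" using C3 by (intro mult_left_mono) auto
    then show ?thesis using small[OF True] by (meson ennreal_leI order_trans)
  next
    case False
    then have "expected_time M b t \<tau> estimator c \<le> ennreal 3"
      using estimator_time_coarse by (simp add: c_def)
    also have "3 * 1 \<le> C * max 1 T" using C3 by (intro mult_mono) auto
    then have "ennreal 3 \<le> ennreal (C * max 1 T)" by (intro ennreal_leI) simp
    finally show ?thesis .
  qed
  moreover have "T \<le> C * (U / (\<gamma>\<^sup>2 * \<epsilon>\<^sup>2 * x)) * ln (2 + real n + 1 / \<gamma> + 1 / E) ^ 2"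
  proof -
    have "T \<le> (5 * real a + 4)\<^sup>2 * (U / (\<gamma>\<^sup>2 * \<epsilon>\<^sup>2 * x)) * ln (2 + real n + 1 / \<gamma> + 1 / E) ^ 2"
      using time_bound_polylog by (simp only: T U E)
    also have "\<dots> \<le> C * (U / (\<gamma>\<^sup>2 * \<epsilon>\<^sup>2 * x)) * ln (2 + real n + 1 / \<gamma> + 1 / E) ^ 2"
      using U0 x0 by (intro mult_right_mono) (auto simp: C)
    finally show ?thesis .
  qed
  ultimately show ?thesis
    using estimator_success unfolding x_def c_def by blast
qed

end

theorem theorem1p6:
  "\<exists>P :: instr list. \<forall>(a :: nat) (\<kappa> :: real). \<kappa> \<ge> 1 \<longrightarrow>
     (\<exists>(C :: real) (k :: nat). C > 0 \<and>
       (\<forall>(n :: nat) (M :: real mat) (b :: real Matrix.vec) (t :: real Matrix.vec)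
          (\<tau> :: nat \<Rightarrow> real) (\<epsilon> :: real) (\<gamma> :: real) (B :: real).
          let x = scalar_prod t (x_star M b);
              E = \<epsilon> * x;
              L = L_param M b t \<gamma> E;
              U = f_row n \<tau> * pnorm 1 t * pnorm \<infinity> (diag_powr M (-1) *\<^sub>v b);
              T = U * L\<^sup>2 / (\<epsilon>\<^sup>2 * x);
              c = init_config M b t \<epsilon> \<gamma> B
          in admissible a n M b t \<and> RDDZ n M \<and>
             (\<forall>i<n. b $ i \<ge> 0) \<and> (\<forall>i<n. t $ i \<ge> 0) \<and> x > 0 \<and>
             \<epsilon> > 0 \<and> 0 < \<gamma> \<and> \<gamma> \<le> gamma_max M \<and>
             (\<forall>v<n. \<tau> v \<ge> 1) \<and>
             max 2 (log_arg M b t \<gamma> E) \<le> B \<and> ln B \<le> \<kappa> * ln (max 2 (log_arg M b t \<gamma> E))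
          \<longrightarrow>
             output_prob M b t P c {y. \<bar>y - x\<bar> \<le> \<epsilon> * x} \<ge> 3/4 \<and>
             (\<epsilon> \<le> 1 \<longrightarrow> expected_time M b t \<tau> P c \<le> ennreal (C * T)) \<and>
             expected_time M b t \<tau> P c \<le> ennreal (C * max 1 T) \<and>
             T \<le> C * (U / (\<gamma>\<^sup>2 * \<epsilon>\<^sup>2 * x)) * ln (2 + real n + 1 / \<gamma> + 1 / E) ^ k))"
proof (intro exI[of _ estimator] allI impI, goal_cases)
  case \<kappa>: (1 a \<kappa>)
  define C where "C = 1132 * (8 + 2 * \<kappa>)\<^sup>2 + (5 * real a + 4)\<^sup>2"
  show ?case
  \<comment> \<open>The exponent 2 of the logarithm comes from the square of \<open>L\<close> in
    \<open>T\<close>.\<close>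
  proof (intro exI[of _ C] exI[of _ 2] conjI allI, goal_cases)
    case 1
    have "0 < (5 * real a + 4)\<^sup>2" by simp
    then show ?case unfolding C_def by (simp add: add_nonneg_pos)
  next
    case (2 n M b t \<tau> \<epsilon> \<gamma> B)
    show ?case
      unfolding Let_def
    proof (rule impI, rule estimation_problem.estimator_guarantees[where \<kappa> = \<kappa> and a = a], goal_cases)
      case 1
      then show ?case using \<kappa> by unfold_locales auto
    qed (rule C_def)
  qed
qed

end
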